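(* Let $D=([n],A)$ be a peo-consistent digraph and let $\equiv$ be a lattice congruence of the acyclic reorientation lattice $\mathrm{AR}_D$. Let $R_D\subseteq \mathrm{AR}_D$ be a set of reorientations obtained by the recursive construction in the context, and let $\Pi_D=\{\pi_E\mid E\in R_D\}\subseteq S_n$. Then Algorithm J with input $\Pi_D$ and initial permutation $\mathrm{id}_n$ generates a sequence $\pi_{E_1},\pi_{E_2},\ldots$ of permutations from $\Pi_D$, where $E_1,E_2,\ldots\in \mathrm{AR}_D$ are such that $[E_1]_\equiv,[E_2]_\equiv,\ldots$ is a Hamilton path in the cover graph of the lattice quotient $\mathrm{AR}_D/{\equiv}$.
   Context: Digraphs are finite, without loops, parallel or antiparallel arcs. A vertex is a source (sink) if it has in-degree (out-degree) zero; a vertex is simplicial in an undirected graph if its neighborhood is a clique. A digraph $D$ is peo-consistent if its vertices can be labeled $1,\ldots,n$ such that either $n=1$, or (i) $n$ is a source or a sink of $D$, (ii) $n$ is simplicial in the underlying undirected graph, and (iii) $D-n$ (with the labels $1,\ldots,n-1$) is peo-consistent. We write $D=([n],A)$ for $D$ with such a labeling, and $D_i$ for the subdigraph induced by $[i]$. Acyclic reorientations. $\mathrm{AR}_D$ is the set of all acyclic digraphs obtained from $D$ by reversing some set of arcs, partially ordered by containment of the sets of arcs reversed with respect to $D$. For peo-consistent $D$ it is a lattice. A lattice congruence $\equiv$ is an equivalence relation such that $x\equiv x'$, $y\equiv y'$ imply $x\vee y\equiv x'\vee y'$ and $x\wedge y\equiv x'\wedge y'$. $[x]_\equiv$ is the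 class of $x$. The lattice quotient $L/{\equiv}$ is the poset on classes with $X<Y$ iff $X\neq Y$ and $x<y$ for some $x\in X,y\in Y$. The cover graph of a poset joins two elements iff one covers the other. Restriction and rails. For $E\in\mathrm{AR}_{D_{n-1}}$, $c(E)\in\mathrm{AR}_D$ is obtained by adding $n$ to $E$ as a source or sink as it appears in $D$ (i.e. no arc at $n$ is reversed), and $\bar c(E)\in\mathrm{AR}_D$ is obtained by adding $n$ with all its arcs reversed with respect to $D$. The restriction $\equiv^*$ is the congruence of $\mathrm{AR}_{D_{n-1}}$ with $E\equiv^*F\Leftrightarrow c(E)\equiv c(F)$. The rail $r(E)$ is the set of all reorientations in $\mathrm{AR}_D$ whose restriction to $D_{n-1}$ is $E$; it is a chain with minimum $c(E)$ and maximum $\bar c(E)$. Construction of $R_D$ (depending on $\equiv$). If $D$ is the empty digraph ($n=0$), $R_D$ consists of the unique (empty) reorientation. Otherwise let $R_{D_{n-1}}\subseteq\mathrm{AR}_{D_{n-1}}$ be the set constructed for $D_{n-1}$ and $\equiv^*$. It is known that exactly one of two cases occurs. Case 1: for every $E\in\mathrm{AR}_{D_{n-1}}$, $c(E)\not\equiv\bar c(E)$. Then for each $E\in R_{D_{n-1}}$ let $R_{r(E)}$ contain exactly one element from $X\cap r(E)$ for each class $X$ of $\equiv$ with $X\cap r(E)\neq\emptyset$, chosen such that $c(E),\bar c(E)\in R_{r(E)}$ (other choices arbitrary), and set $R_D:=\bigcup_{E\in R_{D_{n-1}}}R_{r(E)}$. Case 2: for every $E\in\mathrm{AR}_{D_{n-1}}$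 all elements of $r(E)$ are congruent. Then $R_D:=\{c(E)\mid E\in R_{D_{n-1}}\}$ if $n$ is a sink in $D$, and $R_D:=\{\bar c(E)\mid E\in R_{D_{n-1}}\}$ if $n$ is a source in $D$ (so $n$ is always added as a sink). Encoding by permutations. $S_n$ is the set of permutations of $[n]$ written as words, $\mathrm{id}_n=12\cdots n$, $\varepsilon$ is the empty permutation; for $\pi\in S_{n-1}$, $c_i(\pi)\in S_n$ is obtained by inserting the value $n$ at position $i$. For an acyclic reorientation $E$ of $D$ with restriction $E_{n-1}$ to $[n-1]$, define $\pi_E:=\varepsilon$ if $n=0$ and otherwise: (i) if $n$ is a sink in $E$, $\pi_E:=c_n(\pi_{E_{n-1}})$; (ii) else if $n$ is a source in $E$, $\pi_E:=c_1(\pi_{E_{n-1}})$; (iii) otherwise $\pi_E:=c_i(\pi_{E_{n-1}})$, where $i$ is the position in $\pi_{E_{n-1}}$ of the unique out-neighbor of $n$ in the transitive reduction of $E$ (the digraph of arcs $u\to v$ of $E$ for which $E$ has no other directed path from $u$ to $v$). The map $E\mapsto\pi_E$ is injective. Jumps. Given $\pi=a_1\cdots a_n$ with a substring $a_i\cdots a_{i+d}$, $d>0$, $a_i>a_{i+1},\ldots,a_{i+d}$, a right jump of the value $a_i$ by $d$ steps replaces this substring by $a_{i+1}\cdots a_{i+d}a_i$. Given a substring $a_{i-d}\cdots a_i$, $d>0$, $a_i>a_{i-d},\ldots,a_{i-1}$, a left jump of $a_i$ by $d$ steps replaces it by $a_ia_{i-d}\cdots a_{i-1}$. A jump is minimal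 with respect to $L_n\subseteq S_n$ if every jump of the same value in the same direction by fewer steps creates a permutation not in $L_n$. Algorithm J (input $L_n\subseteq S_n$, initial permutation $\pi_0\in L_n$). J1: Visit $\pi_0$. J2: Generate an unvisited permutation from $L_n$ by performing a minimal jump of the largest possible value in the most recently visited permutation. If no such jump exists, or the jump direction is ambiguous, terminate. Otherwise visit this permutation and repeat J2. *)

theory Defs
  imports "HOL-Algebra.Lattice" "HOL-Combinatorics.Multiset_Permutations"
begin

text \<open>
  A digraph with vertex set \<open>{1..n}\<close> is represented by its set of arcs, the pair \<open>(u, v)\<close> being
  the arc from \<open>u\<close> to \<open>v\<close>.
\<close>

type_synonym arcs = "(nat \<times> nat) set"

text \<open>\<open>asym\<close> excludes loops as well as antiparallel arcs.\<close>

definition digraph_on :: "nat \<Rightarrow> arcs \<Rightarrow> bool" where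
  "digraph_on n A \<longleftrightarrow> A \<subseteq> {1..n} \<times> {1..n} \<and> asym A"

definition induced :: "nat \<Rightarrow> arcs \<Rightarrow> arcs" where
  "induced i A = A \<inter> ({1..i} \<times> {1..i})"

definition is_source :: "arcs \<Rightarrow> nat \<Rightarrow> bool" where
  "is_source A v \<longleftrightarrow> v \<notin> Range A"

definition is_sink :: "arcs \<Rightarrow> nat \<Rightarrow> bool" where
  "is_sink A v \<longleftrightarrow> v \<notin> Domain A"

definition simplicial :: "arcs \<Rightarrow> nat \<Rightarrow> bool" where
  "simplicial A v \<longleftrightarrow>
    (\<forall>u w. (v, u) \<in> A \<union> A\<inverse> \<and> (v, w) \<in> A \<union> A\<inverse> \<and> u \<noteq> w \<longrightarrow> (u, w) \<in> A \<union> A\<inverse>)"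

text \<open>
  Peo-consistency of a digraph on \<open>{1..n}\<close> with respect to the given labels. The digraph without
  vertices, at which the recursive constructions below start, is included.
\<close>

primrec peo_consistent :: "nat \<Rightarrow> arcs \<Rightarrow> bool" where
  "peo_consistent 0 A \<longleftrightarrow> True"
| "peo_consistent (Suc n) A \<longleftrightarrow>
     Suc n = 1 \<or>
     (is_source A (Suc n) \<or> is_sink A (Suc n)) \<and> simplicial A (Suc n) \<and>
     peo_consistent n (induced n A)"


definition reorientation :: "arcs \<Rightarrow> arcs \<Rightarrow> bool" where
  "reorientation A E \<longleftrightarrow> (\<exists>B \<subseteq> A. E = (A - B) \<union> B\<inverse>)"

text \<open>
  For a reorientation \<open>E\<close> of a digraph \<open>A\<close> without antiparallel arcs, \<open>A - E\<close> is the set of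
  reversed arcs.
\<close>

definition AR :: "arcs \<Rightarrow> arcs gorder" where
  "AR A = \<lparr>carrier = {E. reorientation A E \<and> acyclic E}, eq = (=),
           le = (\<lambda>E F. A - E \<subseteq> A - F)\<rparr>"


definition lattice_congruence :: "('a, 'b) gorder_scheme \<Rightarrow> 'a rel \<Rightarrow> bool" where
  "lattice_congruence L r \<longleftrightarrow> equiv (carrier L) r \<and>
    (\<forall>x x' y y'. (x, x') \<in> r \<and> (y, y') \<in> r \<longrightarrow>
      (x \<squnion>\<^bsub>L\<^esub> y, x' \<squnion>\<^bsub>L\<^esub> y') \<in> r \<and> (x \<sqinter>\<^bsub>L\<^esub> y, x' \<sqinter>\<^bsub>L\<^esub> y') \<in> r)"

definition lattice_quotient :: "('a, 'b) gorder_scheme \<Rightarrow> 'a rel \<Rightarrow> 'a set gorder" where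
  "lattice_quotient L r = \<lparr>carrier = carrier L // r, eq = (=),
     le = (\<lambda>X Y. X = Y \<or> (\<exists>x \<in> X. \<exists>y \<in> Y. x \<sqsubset>\<^bsub>L\<^esub> y))\<rparr>"

definition covers :: "('a, 'b) gorder_scheme \<Rightarrow> 'a \<Rightarrow> 'a \<Rightarrow> bool" where
  "covers L y x \<longleftrightarrow> x \<in> carrier L \<and> y \<in> carrier L \<and> x \<sqsubset>\<^bsub>L\<^esub> y \<and>
    \<not> (\<exists>z \<in> carrier L. x \<sqsubset>\<^bsub>L\<^esub> z \<and> z \<sqsubset>\<^bsub>L\<^esub> y)"

definition cover_adjacent :: "('a, 'b) gorder_scheme \<Rightarrow> 'a \<Rightarrow> 'a \<Rightarrow> bool" where
  "cover_adjacent L x y \<longleftrightarrow> covers L x y \<or> covers L y x"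

definition hamilton_path :: "'a set \<Rightarrow> ('a \<Rightarrow> 'a \<Rightarrow> bool) \<Rightarrow> 'a list \<Rightarrow> bool" where
  "hamilton_path V adj xs \<longleftrightarrow> set xs = V \<and> distinct xs \<and> successively adj xs"


text \<open>
  In the next four definitions \<open>A\<close> is a digraph on \<open>{1..Suc n}\<close>. The first two
  add the vertex \<open>Suc n\<close> to a reorientation \<open>E\<close> of \<open>induced n A\<close>, with all its arcs oriented as in
  \<open>A\<close> or all reversed; these are the minimum and the maximum of the rail of \<open>E\<close>.
\<close>

definition add_kept :: "nat \<Rightarrow> arcs \<Rightarrow> arcs \<Rightarrow> arcs" where
  "add_kept n A E = E \<union> {(u, v) \<in> A. u = Suc n \<or> v = Suc n}"

definition add_reversed :: "nat \<Rightarrow> arcs \<Rightarrow> arcs \<Rightarrow> arcs" where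
  "add_reversed n A E = E \<union> {(u, v) \<in> A. u = Suc n \<or> v = Suc n}\<inverse>"

definition rail :: "nat \<Rightarrow> arcs \<Rightarrow> arcs \<Rightarrow> arcs set" where
  "rail n A E = {F \<in> carrier (AR A). induced n F = E}"

definition restrict_congruence :: "nat \<Rightarrow> arcs \<Rightarrow> arcs rel \<Rightarrow> arcs rel" where
  "restrict_congruence n A r =
    {(E, F). E \<in> carrier (AR (induced n A)) \<and> F \<in> carrier (AR (induced n A)) \<and>
             (add_kept n A E, add_kept n A F) \<in> r}"

text \<open>
  \<open>constructed n A r R\<close> says that \<open>R\<close> is one of the possible outcomes of the recursive construction
  of a set of reorientations for the digraph \<open>A\<close> on \<open>{1..n}\<close> and the congruence \<open>r\<close>. The outcome is
  not unique since \<open>S E\<close>, the chosen part of the rail of \<open>E\<close>, is only constrained by the premises.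
\<close>

inductive constructed :: "nat \<Rightarrow> arcs \<Rightarrow> arcs rel \<Rightarrow> arcs set \<Rightarrow> bool" where
  empty: "constructed 0 {} r {{}}"
| separated:
    "constructed (Suc n) A r (\<Union>E \<in> R. S E)"
    if "constructed n (induced n A) (restrict_congruence n A r) R"
      and "\<And>E. E \<in> carrier (AR (induced n A)) \<Longrightarrow> (add_kept n A E, add_reversed n A E) \<notin> r"
      and "\<And>E. E \<in> R \<Longrightarrow> S E \<subseteq> rail n A E"
      and "\<And>E X. \<lbrakk>E \<in> R; X \<in> carrier (AR A) // r; X \<inter> rail n A E \<noteq> {}\<rbrakk> \<Longrightarrow>
             \<exists>!F. F \<in> X \<inter> rail n A E \<and> F \<in> S E"
      and "\<And>E. E \<in> R \<Longrightarrow> add_kept n A E \<in> S E \<and> add_reversed n A E \<in> S E"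
| collapsed_sink:
    "constructed (Suc n) A r (add_kept n A ` R)"
    if "constructed n (induced n A) (restrict_congruence n A r) R"
      and "\<And>E F G. \<lbrakk>E \<in> carrier (AR (induced n A)); F \<in> rail n A E; G \<in> rail n A E\<rbrakk> \<Longrightarrow> (F, G) \<in> r"
      and "is_sink A (Suc n)"
| collapsed_source:
    "constructed (Suc n) A r (add_reversed n A ` R)"
    if "constructed n (induced n A) (restrict_congruence n A r) R"
      and "\<And>E F G. \<lbrakk>E \<in> carrier (AR (induced n A)); F \<in> rail n A E; G \<in> rail n A E\<rbrakk> \<Longrightarrow> (F, G) \<in> r"
      and "is_source A (Suc n)"


text \<open>
  Permutations of \<open>{1..n}\<close> are words, that is, elements of \<open>permutations_of_set {1..n}\<close>. Positions
  in words are counted from 1.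
\<close>

definition insert_at :: "nat \<Rightarrow> 'a \<Rightarrow> 'a list \<Rightarrow> 'a list" where
  "insert_at i x xs = take (i - 1) xs @ x # drop (i - 1) xs"

definition position :: "'a list \<Rightarrow> 'a \<Rightarrow> nat" where
  "position xs x = (THE i. 1 \<le> i \<and> i \<le> length xs \<and> xs ! (i - 1) = x)"

definition transitive_reduction :: "arcs \<Rightarrow> arcs" where
  "transitive_reduction E = {(u, v) \<in> E. (u, v) \<notin> (E - {(u, v)})\<^sup>+}"

primrec perm_of :: "nat \<Rightarrow> arcs \<Rightarrow> nat list" where
  "perm_of 0 E = []"
| "perm_of (Suc n) E =
    (let p = perm_of n (induced n E) in
     if is_sink E (Suc n) then insert_at (Suc n) (Suc n) p
     else if is_source E (Suc n) then insert_at 1 (Suc n) p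
     else insert_at (position p (THE v. (Suc n, v) \<in> transitive_reduction E)) (Suc n) p)"


datatype direction = Leftward | Rightward

text \<open>\<open>jump dir p a d q\<close>: a jump of the value \<open>a\<close> by \<open>d\<close> steps changes \<open>p\<close> into \<open>q\<close>.\<close>

fun jump :: "direction \<Rightarrow> nat list \<Rightarrow> nat \<Rightarrow> nat \<Rightarrow> nat list \<Rightarrow> bool" where
  "jump Rightward p a d q \<longleftrightarrow>
    (\<exists>xs ys zs. p = xs @ [a] @ ys @ zs \<and> q = xs @ ys @ [a] @ zs \<and>
      length ys = d \<and> d > 0 \<and> (\<forall>y \<in> set ys. a > y))"
| "jump Leftward p a d q \<longleftrightarrow>
    (\<exists>xs ys zs. p = xs @ ys @ [a] @ zs \<and> q = xs @ [a] @ ys @ zs \<and>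
      length ys = d \<and> d > 0 \<and> (\<forall>y \<in> set ys. a > y))"

definition minimal_jump ::
    "nat list set \<Rightarrow> direction \<Rightarrow> nat list \<Rightarrow> nat \<Rightarrow> nat \<Rightarrow> nat list \<Rightarrow> bool" where
  "minimal_jump L dir p a d q \<longleftrightarrow> jump dir p a d q \<and>
    (\<forall>d' q'. d' < d \<and> jump dir p a d' q' \<longrightarrow> q' \<notin> L)"

text \<open>
  In the algorithm, \<open>ps\<close> is the list of permutations visited so far in the order of the visits.
  The value \<open>a\<close> is possible if some minimal jump of \<open>a\<close> creates an unvisited permutation in \<open>L\<close>; the
  direction is ambiguous if for the largest possible value there are such jumps in both directions.
\<close>

definition admissible ::
    "nat list set \<Rightarrow> nat list list \<Rightarrow> direction \<Rightarrow> nat \<Rightarrow> nat list \<Rightarrow> bool" where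
  "admissible L ps dir a q \<longleftrightarrow> (\<exists>d. minimal_jump L dir (last ps) a d q) \<and> q \<in> L \<and> q \<notin> set ps"

definition algorithm_J_step :: "nat list set \<Rightarrow> nat list list \<Rightarrow> nat list \<Rightarrow> bool" where
  "algorithm_J_step L ps q \<longleftrightarrow> (\<exists>dir a. admissible L ps dir a q \<and>
     (\<forall>dir' a' q'. admissible L ps dir' a' q' \<longrightarrow> a' \<le> a) \<and>
     (\<forall>dir' q'. admissible L ps dir' a q' \<longrightarrow> dir' = dir))"

inductive algorithm_J_visits ::
    "nat \<Rightarrow> nat list set \<Rightarrow> nat list \<Rightarrow> nat list list \<Rightarrow> bool" for n L p0 where
  J1: "\<lbrakk>L \<subseteq> permutations_of_set {1..n}; p0 \<in> L\<rbrakk> \<Longrightarrow> algorithm_J_visits n L p0 [p0]"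
| J2: "\<lbrakk>algorithm_J_visits n L p0 ps; algorithm_J_step L ps q\<rbrakk> \<Longrightarrow>
         algorithm_J_visits n L p0 (ps @ [q])"

text \<open>The complete sequence of visited permutations, up to termination.\<close>

definition algorithm_J_generates ::
    "nat \<Rightarrow> nat list set \<Rightarrow> nat list \<Rightarrow> nat list list \<Rightarrow> bool" where
  "algorithm_J_generates n L p0 ps \<longleftrightarrow>
     algorithm_J_visits n L p0 ps \<and> \<not> (\<exists>q. algorithm_J_step L ps q)"

end

theory Submission
  imports Defs
begin

text \<open>
  Write \<open>c\<close> and \<open>cbar\<close> for the two extensions of a reorientation of \<open>D\<close> without its last
  vertex by a vertex with all arcs kept or all arcs reversed. They are the left and the right
  adjoint of the restriction map, their images are a down-set and an up-set, and the rail of \<open>E\<close>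
  is the interval from \<open>c E\<close> to \<open>cbar E\<close>. Hence a congruence descends along restriction,
  covers of the restricted quotient lift along both \<open>c\<close> and \<open>cbar\<close>, and classes which meet
  a rail consecutively cover each other. So the classes of the chosen reorientations form a
  Hamilton path if the rails are traversed alternately in opposite directions, along a Hamilton
  path of the restricted quotient. The position of the largest value in \<open>perm_of\<close> is strictly
  monotone on each rail, so this zigzag is what Algorithm J does: it moves the largest value
  through all its positions, in the only direction which is not yet visited, and performs a step
  for the smaller values when the largest value is stuck at the border.
\<close>


section \<open>Covers in lattice quotients\<close>

text \<open>The order on classes asks for just one comparable pair of representatives, so covers of
  a quotient are awkward to transport directly. They are traded for \<open>separates\<close>, a
  condition on elements of the lattice, which \<open>c\<close> and \<open>cbar\<close> transport
  because no element between two images leaves the image. Congruences are moved along rails by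
  lattice polynomials: meeting with a suitable \<open>c E\<close> projects to bottoms of rails,
  joining with a suitable \<open>cbar E\<close> projects to tops, and both operations respect
  \<open>r\<close>.

  That \<open>AR A\<close> is a lattice is not assumed but proved by induction on the vertices.
  Joins are built for a new source, a new sink is treated by reversing all arcs, and meets come from
  the joins for the reversed digraph.

  The zigzag relies on both ends of every rail being chosen: with the largest value at a border, the
  jumps of smaller values are those of the shorter permutation. In the collapsed case each rail
  contributes a single permutation, with the largest value at the right end, and the shorter run is
  simply copied.\<close>

locale congruent_lattice = lattice L for L :: "'a gorder" (structure) +
  fixes r :: "'a rel"
  assumes lattice_congruence: "lattice_congruence L r"
begin

lemma equiv_r: "equiv (carrier L) r"
  using lattice_congruence by (simp add: lattice_congruence_def)

lemma r_sym: "(x, y) \<in> r \<Longrightarrow> (y, x) \<in> r"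
  using equiv_r by (meson equivE symE)

lemma r_trans: "(x, y) \<in> r \<Longrightarrow> (y, z) \<in> r \<Longrightarrow> (x, z) \<in> r"
  using equiv_r by (meson equivE transE)

lemma r_refl: "x \<in> carrier L \<Longrightarrow> (x, x) \<in> r"
  using equiv_r by (meson equivE refl_onD)

lemma r_carrier: "(x, y) \<in> r \<Longrightarrow> x \<in> carrier L \<and> y \<in> carrier L"
  using equiv_r r_sym by (metis Image_singleton_iff equiv_class_eq_iff)

lemma r_join: "(x, x') \<in> r \<Longrightarrow> (y, y') \<in> r \<Longrightarrow> (x \<squnion> y, x' \<squnion> y') \<in> r"
  using lattice_congruence by (simp add: lattice_congruence_def)

lemma r_meet: "(x, x') \<in> r \<Longrightarrow> (y, y') \<in> r \<Longrightarrow> (x \<sqinter> y, x' \<sqinter> y') \<in> r"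
  using lattice_congruence by (simp add: lattice_congruence_def)

lemma class_eq_iff:
  "x \<in> carrier L \<Longrightarrow> y \<in> carrier L \<Longrightarrow> r `` {x} = r `` {y} \<longleftrightarrow> (x, y) \<in> r"
  using equiv_r by (simp add: eq_equiv_class_iff)

lemma join_absorb: "x \<in> carrier L \<Longrightarrow> y \<in> carrier L \<Longrightarrow> x \<sqsubseteq> y \<Longrightarrow> x \<squnion> y = y"
  by (simp add: le_iff_meet)

lemma meet_absorb: "x \<in> carrier L \<Longrightarrow> y \<in> carrier L \<Longrightarrow> x \<sqsubseteq> y \<Longrightarrow> x \<sqinter> y = x"
  by (simp add: le_iff_join)

text \<open>Joining both sides of \<open>(x, z) \<in> r\<close> with \<open>y\<close> gives
  \<open>(y, z) \<in> r\<close>, and transitivity does the rest.\<close>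

lemma r_convex:
  assumes "x \<in> carrier L" "y \<in> carrier L" "z \<in> carrier L" "x \<sqsubseteq> y" "y \<sqsubseteq> z" "(x, z) \<in> r"
  shows "(x, y) \<in> r"
proof -
  have "(x \<squnion> y, z \<squnion> y) \<in> r"
    using assms by (intro r_join r_refl)
  moreover have "x \<squnion> y = y" "z \<squnion> y = z"
    using assms join_absorb join_comm[of L] by metis+
  ultimately show ?thesis
    using assms r_sym r_trans by metis
qed

text \<open>The interval from \<open>x\<close> to \<open>y\<close> meets exactly two classes. By the
  next lemmas, a cover of classes is the same as the existence of such a pair of representatives;
  being a condition inside \<open>L\<close>, it can be carried between lattices.\<close>

definition separates :: "'a \<Rightarrow> 'a \<Rightarrow> bool" where
  "separates x y \<longleftrightarrow> x \<in> carrier L \<and> y \<in> carrier L \<and> x \<sqsubseteq> y \<and> (x, y) \<notin> r \<and>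
    (\<forall>z \<in> carrier L. x \<sqsubseteq> z \<and> z \<sqsubseteq> y \<longrightarrow> (x, z) \<in> r \<or> (z, y) \<in> r)"

lemma quotient_less_iff:
  assumes "x \<in> carrier L" "y \<in> carrier L"
  shows "(r `` {x}) \<sqsubset>\<^bsub>lattice_quotient L r\<^esub> (r `` {y}) \<longleftrightarrow>
    (x, y) \<notin> r \<and> (\<exists>x' y'. (x, x') \<in> r \<and> (y, y') \<in> r \<and> x' \<sqsubseteq> y')"
proof
  assume "(r `` {x}) \<sqsubset>\<^bsub>lattice_quotient L r\<^esub> (r `` {y})"
  then show "(x, y) \<notin> r \<and> (\<exists>x' y'. (x, x') \<in> r \<and> (y, y') \<in> r \<and> x' \<sqsubseteq> y')"
    using assms class_eq_iff[OF assms] by (auto simp: lattice_quotient_def lless_def)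
next
  assume *: "(x, y) \<notin> r \<and> (\<exists>x' y'. (x, x') \<in> r \<and> (y, y') \<in> r \<and> x' \<sqsubseteq> y')"
  then obtain x' y' where "(x, x') \<in> r" "(y, y') \<in> r" "x' \<sqsubseteq> y'" by blast
  moreover from this * have "x' \<noteq> y'" using r_sym r_trans by metis
  ultimately show "(r `` {x}) \<sqsubset>\<^bsub>lattice_quotient L r\<^esub> (r `` {y})"
    using * class_eq_iff[OF assms] eq_is_equal by (auto simp: lattice_quotient_def lless_def)
qed

lemma carrier_quotient: "carrier (lattice_quotient L r) = carrier L // r"
  by (simp add: lattice_quotient_def)

text \<open>A class between two classes meets every interval spanned by comparable representatives.\<close>

lemma separates_imp_covers:
  assumes "separates x y"
  shows "covers (lattice_quotient L r) (r `` {y}) (r `` {x})"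
proof -
  have x: "x \<in> carrier L" and y: "y \<in> carrier L" and xy: "x \<sqsubseteq> y" and ne: "(x, y) \<notin> r"
    and between: "\<And>z. z \<in> carrier L \<Longrightarrow> x \<sqsubseteq> z \<Longrightarrow> z \<sqsubseteq> y \<Longrightarrow> (x, z) \<in> r \<or> (z, y) \<in> r"
    using assms by (auto simp: separates_def)
  have False
    if z: "z \<in> carrier L" and "(r `` {x}) \<sqsubset>\<^bsub>lattice_quotient L r\<^esub> (r `` {z})"
      "(r `` {z}) \<sqsubset>\<^bsub>lattice_quotient L r\<^esub> (r `` {y})" for z
  proof -
    from that obtain x1 z1 z2 y2 where nxz: "(x, z) \<notin> r" and nzy: "(z, y) \<notin> r"
      and x1: "(x, x1) \<in> r" and z1: "(z, z1) \<in> r" and le1: "x1 \<sqsubseteq> z1"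
      and z2: "(z, z2) \<in> r" and y2: "(y, y2) \<in> r" and le2: "z2 \<sqsubseteq> y2"
      using x y by (auto simp: quotient_less_iff)
    note cl = x y z r_carrier[OF x1] r_carrier[OF z1] r_carrier[OF z2] r_carrier[OF y2]
    \<comment> \<open>The two comparisons involve unrelated representatives of the class of
      \<open>z\<close>. The join with \<open>x\<close> lifts \<open>z1\<close> above
      \<open>x\<close> and the meet with \<open>y\<close> pushes the result below \<open>y\<close>,
      both without leaving the class, so \<open>w\<close> is a representative of that class inside
      the interval.\<close>
    define w where "w = (x \<squnion> z1) \<sqinter> y"
    have w: "w \<in> carrier L" using cl by (simp add: w_def)
    have "(x \<squnion> z1, x1 \<squnion> z1) \<in> r" using cl x1 by (intro r_join r_refl) auto
    then have "(x \<squnion> z1, z1) \<in> r" using cl le1 join_absorb by simp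
    then have "(x \<squnion> z1, z2) \<in> r" using z1 z2 r_sym r_trans by blast
    then have "(w, z2 \<sqinter> y2) \<in> r" unfolding w_def using y2 by (rule r_meet)
    then have wz: "(w, z) \<in> r" using cl le2 meet_absorb z2 r_sym r_trans by metis
    have "x \<sqsubseteq> w" unfolding w_def using cl xy by (intro meet_le join_left) auto
    moreover have "w \<sqsubseteq> y" unfolding w_def using cl by (intro meet_right) auto
    ultimately have "(x, w) \<in> r \<or> (w, y) \<in> r" using between w by blast
    with wz nxz nzy show False using r_sym r_trans by blast
  qed
  moreover have "(r `` {x}) \<sqsubset>\<^bsub>lattice_quotient L r\<^esub> (r `` {y})"
    unfolding quotient_less_iff[OF x y] using x y xy ne r_refl by blast
  ultimately show ?thesis
    using x y unfolding covers_def carrier_quotient quotient_def by fastforce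
qed

text \<open>Any comparable representatives of the two classes will do: an element between them that
  is congruent to neither would yield a class strictly in between.\<close>

lemma covers_imp_separates:
  assumes x: "x \<in> carrier L" and y: "y \<in> carrier L"
    and cov: "covers (lattice_quotient L r) (r `` {y}) (r `` {x})"
  shows "\<exists>x' y'. (x, x') \<in> r \<and> (y, y') \<in> r \<and> separates x' y'"
proof -
  have "(r `` {x}) \<sqsubset>\<^bsub>lattice_quotient L r\<^esub> (r `` {y})"
    using cov by (simp add: covers_def)
  then obtain x' y' where ne: "(x, y) \<notin> r"
    and x': "(x, x') \<in> r" and y': "(y, y') \<in> r" and le: "x' \<sqsubseteq> y'"
    using x y by (auto simp: quotient_less_iff)
  have "(x', z) \<in> r \<or> (z, y') \<in> r" if "z \<in> carrier L" "x' \<sqsubseteq> z" "z \<sqsubseteq> y'" for z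
  proof (rule ccontr)
    assume n: "\<not> ((x', z) \<in> r \<or> (z, y') \<in> r)"
    have "(r `` {x}) \<sqsubset>\<^bsub>lattice_quotient L r\<^esub> (r `` {z})"
      unfolding quotient_less_iff[OF x that(1)] using n that x' r_refl r_sym r_trans by blast
    moreover have "(r `` {z}) \<sqsubset>\<^bsub>lattice_quotient L r\<^esub> (r `` {y})"
      unfolding quotient_less_iff[OF that(1) y] using n that y' r_refl r_sym r_trans by blast
    moreover have "r `` {z} \<in> carrier (lattice_quotient L r)"
      using that by (simp add: carrier_quotient quotientI)
    ultimately show False using cov by (auto simp: covers_def)
  qed
  then have "separates x' y'"
    unfolding separates_def using le r_carrier[OF x'] r_carrier[OF y'] ne x' y'
    by (meson r_sym r_trans)
  then show ?thesis using x' y' by blast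
qed

lemma covers_quotient_cong:
  assumes "(x, x') \<in> r" "(y, y') \<in> r"
  shows "r `` {x} = r `` {x'}" "r `` {y} = r `` {y'}"
  using assms class_eq_iff r_carrier by blast+

end


section \<open>Extending a lattice by rails\<close>

locale rail_extension = congruent_lattice L r + M: lattice M
  for L :: "'a gorder" (structure) and r :: "'a rel" and M :: "'b gorder" +
  fixes res :: "'a \<Rightarrow> 'b" and c cbar :: "'b \<Rightarrow> 'a"
  assumes res_closed: "x \<in> carrier L \<Longrightarrow> res x \<in> carrier M"
    and c_closed: "E \<in> carrier M \<Longrightarrow> c E \<in> carrier L"
    and cbar_closed: "E \<in> carrier M \<Longrightarrow> cbar E \<in> carrier L"
    and res_c: "E \<in> carrier M \<Longrightarrow> res (c E) = E"
    and res_cbar: "E \<in> carrier M \<Longrightarrow> res (cbar E) = E"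
    and c_le_iff: "E \<in> carrier M \<Longrightarrow> x \<in> carrier L \<Longrightarrow> c E \<sqsubseteq> x \<longleftrightarrow> E \<sqsubseteq>\<^bsub>M\<^esub> res x"
    and le_cbar_iff: "E \<in> carrier M \<Longrightarrow> x \<in> carrier L \<Longrightarrow> x \<sqsubseteq> cbar E \<longleftrightarrow> res x \<sqsubseteq>\<^bsub>M\<^esub> E"
    and c_down: "E \<in> carrier M \<Longrightarrow> x \<in> carrier L \<Longrightarrow> x \<sqsubseteq> c E \<Longrightarrow> c (res x) = x"
    and cbar_up: "E \<in> carrier M \<Longrightarrow> x \<in> carrier L \<Longrightarrow> cbar E \<sqsubseteq> x \<Longrightarrow> cbar (res x) = x"
begin

lemma c_le_c: "E \<in> carrier M \<Longrightarrow> F \<in> carrier M \<Longrightarrow> c E \<sqsubseteq> c F \<longleftrightarrow> E \<sqsubseteq>\<^bsub>M\<^esub> F"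
  by (simp add: c_le_iff c_closed res_c)

lemma cbar_le_cbar: "E \<in> carrier M \<Longrightarrow> F \<in> carrier M \<Longrightarrow> cbar E \<sqsubseteq> cbar F \<longleftrightarrow> E \<sqsubseteq>\<^bsub>M\<^esub> F"
  by (simp add: le_cbar_iff cbar_closed res_cbar)

lemma c_res_le: "x \<in> carrier L \<Longrightarrow> c (res x) \<sqsubseteq> x"
  by (simp add: c_le_iff res_closed)

lemma le_cbar_res: "x \<in> carrier L \<Longrightarrow> x \<sqsubseteq> cbar (res x)"
  by (simp add: le_cbar_iff res_closed)

lemma res_mono:
  assumes "x \<in> carrier L" "y \<in> carrier L" "x \<sqsubseteq> y"
  shows "res x \<sqsubseteq>\<^bsub>M\<^esub> res y"
  using assms c_res_le[OF assms(1)] c_le_iff res_closed c_closed le_trans by meson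

text \<open>The meet lies below \<open>c E\<close>, hence is itself of the form \<open>c G\<close>
  by \<open>c_down\<close>, with \<open>G\<close> below \<open>res x\<close>. This expresses the
  projection of \<open>x\<close> to the bottom of its rail as a lattice operation, which congruences
  respect.\<close>

lemma meet_c:
  assumes "x \<in> carrier L" "E \<in> carrier M" "res x \<sqsubseteq>\<^bsub>M\<^esub> E"
  shows "x \<sqinter> c E = c (res x)"
proof (rule le_antisym)
  have cE: "c E \<in> carrier L" and m: "x \<sqinter> c E \<in> carrier L" using assms c_closed by simp_all
  have "x \<sqinter> c E \<sqsubseteq> c E" using assms(1) cE by (rule meet_right)
  then have "c (res (x \<sqinter> c E)) = x \<sqinter> c E" using c_down assms(2) m by blast
  moreover have "res (x \<sqinter> c E) \<sqsubseteq>\<^bsub>M\<^esub> res x"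
    using m assms(1) cE by (intro res_mono meet_left)
  ultimately show "x \<sqinter> c E \<sqsubseteq> c (res x)"
    using c_le_c m assms(1) res_closed by metis
  show "c (res x) \<sqsubseteq> x \<sqinter> c E"
    using assms cE by (intro meet_le) (auto simp: c_res_le c_le_c res_closed c_closed)
qed (use assms c_closed res_closed in auto)

lemma join_cbar:
  assumes "x \<in> carrier L" "E \<in> carrier M" "E \<sqsubseteq>\<^bsub>M\<^esub> res x"
  shows "x \<squnion> cbar E = cbar (res x)"
proof (rule le_antisym)
  have cE: "cbar E \<in> carrier L" and m: "x \<squnion> cbar E \<in> carrier L"
    using assms cbar_closed by simp_all
  have "cbar E \<sqsubseteq> x \<squnion> cbar E" using assms(1) cE by (rule join_right)
  then have "cbar (res (x \<squnion> cbar E)) = x \<squnion> cbar E" using cbar_up assms(2) m by blast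
  moreover have "res x \<sqsubseteq>\<^bsub>M\<^esub> res (x \<squnion> cbar E)"
    using m assms(1) cE by (intro res_mono join_left)
  ultimately show "cbar (res x) \<sqsubseteq> x \<squnion> cbar E"
    using cbar_le_cbar m assms(1) res_closed by metis
  show "x \<squnion> cbar E \<sqsubseteq> cbar (res x)"
    using assms cE by (intro join_le) (auto simp: le_cbar_res cbar_le_cbar res_closed cbar_closed)
qed (use assms cbar_closed res_closed in auto)

section \<open>The restricted congruence\<close>

definition restricted :: "'b rel" where
  "restricted = {(E, F). E \<in> carrier M \<and> F \<in> carrier M \<and> (c E, c F) \<in> r}"

text \<open>One meet, with \<open>c\<close> of the join of both restrictions, lowers
  \<open>x\<close> and \<open>y\<close> simultaneously to the bottoms of their rails.\<close>

lemma restricted_res: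
  assumes "(x, y) \<in> r"
  shows "(res x, res y) \<in> restricted"
proof -
  have cl: "x \<in> carrier L" "y \<in> carrier L" "res x \<in> carrier M" "res y \<in> carrier M"
    using r_carrier[OF assms] res_closed by auto
  let ?E = "res x \<squnion>\<^bsub>M\<^esub> res y"
  have E: "?E \<in> carrier M" using cl by simp
  have "(x \<sqinter> c ?E, y \<sqinter> c ?E) \<in> r"
    using assms E c_closed by (intro r_meet r_refl) auto
  moreover have "x \<sqinter> c ?E = c (res x)" "y \<sqinter> c ?E = c (res y)"
    using cl E by (auto intro!: meet_c M.join_left M.join_right)
  ultimately show ?thesis using cl by (simp add: restricted_def)
qed

text \<open>Dually, joining with \<open>cbar\<close> of the meet of \<open>E\<close> and
  \<open>F\<close> raises both bottoms to the tops of their rails. Hence bottoms and tops of rails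
  induce the same congruence on \<open>M\<close>.\<close>

lemma restricted_cbar:
  assumes "(E, F) \<in> restricted"
  shows "(cbar E, cbar F) \<in> r"
proof -
  have cl: "E \<in> carrier M" "F \<in> carrier M" "(c E, c F) \<in> r"
    using assms by (auto simp: restricted_def)
  let ?G = "E \<sqinter>\<^bsub>M\<^esub> F"
  have G: "?G \<in> carrier M" using cl by simp
  have "(c E \<squnion> cbar ?G, c F \<squnion> cbar ?G) \<in> r"
    using cl G cbar_closed by (intro r_join r_refl) auto
  moreover have "c E \<squnion> cbar ?G = cbar E" "c F \<squnion> cbar ?G = cbar F"
    using cl G by (simp_all add: join_cbar c_closed res_c M.meet_left M.meet_right)
  ultimately show ?thesis by simp
qed

text \<open>The polynomial \<open>(x \<sqinter> cbar F) \<squnion> c F\<close> clamps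
  \<open>x\<close> between the ends of the rail of \<open>F\<close>. Clamping to its own rail
  returns \<open>x\<close>, and replacing \<open>res x\<close> by the congruent \<open>F\<close>
  changes both ends only up to \<open>r\<close>.\<close>

lemma restricted_rail:
  assumes x: "x \<in> carrier L" and xF: "(res x, F) \<in> restricted"
  obtains y where "y \<in> carrier L" "res y = F" "(x, y) \<in> r"
proof
  have F: "F \<in> carrier M" and cl: "c F \<in> carrier L" "cbar F \<in> carrier L"
    using xF c_closed cbar_closed by (auto simp: restricted_def)
  define y where "y = (x \<sqinter> cbar F) \<squnion> c F"
  show y: "y \<in> carrier L" using x cl by (simp add: y_def)
  have "y \<sqsubseteq> cbar F"
    unfolding y_def using x F cl
    by (intro join_le meet_right) (auto simp: le_cbar_iff res_c)
  moreover have "c F \<sqsubseteq> y" unfolding y_def using x cl by (intro join_right) auto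
  ultimately show "res y = F"
    using y F res_closed by (auto simp: le_cbar_iff c_le_iff intro: M.le_antisym)
  have "((x \<sqinter> cbar (res x)) \<squnion> c (res x), y) \<in> r"
    unfolding y_def using restricted_cbar[OF xF] xF x
    by (intro r_join r_meet r_refl) (auto simp: restricted_def)
  moreover have "(x \<sqinter> cbar (res x)) \<squnion> c (res x) = x"
    using x c_res_le le_cbar_res meet_absorb join_absorb join_comm[of L]
      res_closed c_closed cbar_closed by metis
  ultimately show "(x, y) \<in> r" by simp
qed

lemma c_join:
  assumes "E \<in> carrier M" "F \<in> carrier M"
  shows "c (E \<squnion>\<^bsub>M\<^esub> F) = c E \<squnion> c F"
proof (rule le_antisym)
  have cl: "c E \<in> carrier L" "c F \<in> carrier L" "c E \<squnion> c F \<in> carrier L" "E \<squnion>\<^bsub>M\<^esub> F \<in> carrier M"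
    using assms c_closed by simp_all
  show "c E \<squnion> c F \<sqsubseteq> c (E \<squnion>\<^bsub>M\<^esub> F)"
    using assms cl by (intro join_le) (auto simp: c_le_c c_closed M.join_left M.join_right)
  show "c (E \<squnion>\<^bsub>M\<^esub> F) \<sqsubseteq> c E \<squnion> c F"
    using assms cl join_left[of "c E" "c F"] join_right[of "c E" "c F"]
    by (auto simp: c_le_iff res_closed intro!: M.join_le)
qed (use assms c_closed in auto)

text \<open>A left adjoint preserves joins, but not meets in general. Meets are preserved here
  because the image of \<open>c\<close> is a down-set, so the meet of \<open>c E\<close> and
  \<open>c F\<close> is again in the image.\<close>

lemma c_meet:
  assumes "E \<in> carrier M" "F \<in> carrier M"
  shows "c (E \<sqinter>\<^bsub>M\<^esub> F) = c E \<sqinter> c F"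
proof (rule le_antisym)
  have cl: "c E \<in> carrier L" "c F \<in> carrier L" "c E \<sqinter> c F \<in> carrier L" "E \<sqinter>\<^bsub>M\<^esub> F \<in> carrier M"
    using assms c_closed by simp_all
  show "c (E \<sqinter>\<^bsub>M\<^esub> F) \<sqsubseteq> c E \<sqinter> c F"
    using assms cl by (intro meet_le) (auto simp: c_le_c c_closed M.meet_left M.meet_right)
  have "c (res (c E \<sqinter> c F)) = c E \<sqinter> c F"
    using assms(1) cl(3) by (rule c_down) (use cl in \<open>simp add: meet_left\<close>)
  moreover have "res (c E \<sqinter> c F) \<sqsubseteq>\<^bsub>M\<^esub> E \<sqinter>\<^bsub>M\<^esub> F"
    using assms cl res_mono[of "c E \<sqinter> c F" "c E"] res_mono[of "c E \<sqinter> c F" "c F"]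
    by (intro M.meet_le) (auto simp: res_c res_closed meet_left meet_right)
  ultimately show "c E \<sqinter> c F \<sqsubseteq> c (E \<sqinter>\<^bsub>M\<^esub> F)"
    using cl c_le_c res_closed by metis
qed (use assms c_closed in auto)

lemma restricted_congruence: "lattice_congruence M restricted"
  unfolding lattice_congruence_def
proof (intro conjI allI impI equivI)
  show "refl_on (carrier M) restricted"
    by (auto intro!: refl_onI simp: restricted_def r_refl c_closed)
  show "sym restricted"
    by (auto intro!: symI simp: restricted_def r_sym)
  show "trans restricted"
    by (auto intro!: transI simp: restricted_def intro: r_trans)
  fix x x' y y' assume a: "(x, x') \<in> restricted \<and> (y, y') \<in> restricted"
  then show "(x \<squnion>\<^bsub>M\<^esub> y, x' \<squnion>\<^bsub>M\<^esub> y') \<in> restricted" "(x \<sqinter>\<^bsub>M\<^esub> y, x' \<sqinter>\<^bsub>M\<^esub> y') \<in> restricted"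
    by (auto simp: restricted_def c_join c_meet r_join r_meet)
qed (auto simp: restricted_def)

sublocale restriction: congruent_lattice M restricted
  by unfold_locales (rule restricted_congruence)

text \<open>Everything below \<open>c F\<close> is in the image of \<open>c\<close>, so the interval
  from \<open>c E\<close> to \<open>c F\<close> is a copy of the one from \<open>E\<close> to
  \<open>F\<close>.\<close>

lemma separates_c:
  assumes "restriction.separates E F"
  shows "separates (c E) (c F)"
proof -
  have cl: "E \<in> carrier M" "F \<in> carrier M" and EF: "E \<sqsubseteq>\<^bsub>M\<^esub> F" "(E, F) \<notin> restricted"
    and between: "\<And>G. G \<in> carrier M \<Longrightarrow> E \<sqsubseteq>\<^bsub>M\<^esub> G \<Longrightarrow> G \<sqsubseteq>\<^bsub>M\<^esub> F \<Longrightarrow>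
      (E, G) \<in> restricted \<or> (G, F) \<in> restricted"
    using assms by (auto simp: restriction.separates_def)
  have "(c E, z) \<in> r \<or> (z, c F) \<in> r" if z: "z \<in> carrier L" "c E \<sqsubseteq> z" "z \<sqsubseteq> c F" for z
  proof -
    have "c (res z) = z" using c_down cl z by blast
    moreover have "E \<sqsubseteq>\<^bsub>M\<^esub> res z" using z cl by (simp add: c_le_iff)
    moreover have "res z \<sqsubseteq>\<^bsub>M\<^esub> F" using z cl res_mono[of z "c F"] by (simp add: c_closed res_c)
    ultimately show ?thesis using between[of "res z"] z res_closed by (auto simp: restricted_def)
  qed
  then show ?thesis
    using cl EF by (auto simp: separates_def c_closed c_le_c restricted_def)
qed

lemma restricted_iff_cbar:
  assumes "E \<in> carrier M" "F \<in> carrier M"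
  shows "(E, F) \<in> restricted \<longleftrightarrow> (cbar E, cbar F) \<in> r"
  using restricted_cbar restricted_res[of "cbar E" "cbar F"] res_cbar assms by auto

lemma separates_cbar:
  assumes "restriction.separates E F"
  shows "separates (cbar E) (cbar F)"
proof -
  have cl: "E \<in> carrier M" "F \<in> carrier M" and EF: "E \<sqsubseteq>\<^bsub>M\<^esub> F" "(E, F) \<notin> restricted"
    and between: "\<And>G. G \<in> carrier M \<Longrightarrow> E \<sqsubseteq>\<^bsub>M\<^esub> G \<Longrightarrow> G \<sqsubseteq>\<^bsub>M\<^esub> F \<Longrightarrow>
      (E, G) \<in> restricted \<or> (G, F) \<in> restricted"
    using assms by (auto simp: restriction.separates_def)
  have "(cbar E, z) \<in> r \<or> (z, cbar F) \<in> r"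
    if z: "z \<in> carrier L" "cbar E \<sqsubseteq> z" "z \<sqsubseteq> cbar F" for z
  proof -
    have "cbar (res z) = z" using cbar_up cl z by blast
    moreover have "res z \<sqsubseteq>\<^bsub>M\<^esub> F" using z cl by (simp add: le_cbar_iff)
    moreover have "E \<sqsubseteq>\<^bsub>M\<^esub> res z"
      using z cl res_mono[of "cbar E" z] by (simp add: cbar_closed res_cbar)
    ultimately show ?thesis
      using between[of "res z"] z res_closed restricted_cbar by metis
  qed
  then show ?thesis
    using cl EF by (auto simp: separates_def cbar_closed cbar_le_cbar restricted_iff_cbar)
qed

text \<open>Both versions are needed since the zigzag passes from one rail to the next alternately
  at either end.\<close>

lemma cover_adjacent_c:
  assumes "E \<in> carrier M" "F \<in> carrier M"
    "cover_adjacent (lattice_quotient M restricted) (restricted `` {E}) (restricted `` {F})"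
  shows "cover_adjacent (lattice_quotient L r) (r `` {c E}) (r `` {c F})"
    and "cover_adjacent (lattice_quotient L r) (r `` {cbar E}) (r `` {cbar F})"
proof -
  have cov: "covers (lattice_quotient L r) (r `` {c F}) (r `` {c E}) \<and>
    covers (lattice_quotient L r) (r `` {cbar F}) (r `` {cbar E})"
    if EF: "E \<in> carrier M" "F \<in> carrier M"
      "covers (lattice_quotient M restricted) (restricted `` {F}) (restricted `` {E})" for E F
  proof -
    obtain E' F' where E': "(E, E') \<in> restricted" and F': "(F, F') \<in> restricted"
      and sep: "restriction.separates E' F'"
      using restriction.covers_imp_separates[OF EF] by blast
    have "r `` {c E} = r `` {c E'}" "r `` {c F} = r `` {c F'}"
      using E' F' by (auto simp: restricted_def class_eq_iff c_closed)
    moreover have "r `` {cbar E} = r `` {cbar E'}" "r `` {cbar F} = r `` {cbar F'}"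
      using covers_quotient_cong[OF restricted_cbar[OF E'] restricted_cbar[OF F']] by auto
    ultimately show ?thesis
      using separates_imp_covers[OF separates_c[OF sep]]
        separates_imp_covers[OF separates_cbar[OF sep]] by simp
  qed
  show "cover_adjacent (lattice_quotient L r) (r `` {c E}) (r `` {c F})"
    "cover_adjacent (lattice_quotient L r) (r `` {cbar E}) (r `` {cbar F})"
    using assms(3) cov[OF assms(1,2)] cov[OF assms(2,1)] unfolding cover_adjacent_def by blast+
qed

end


section \<open>Acyclic reorientations of peo-consistent digraphs\<close>

lemma acyclic_imp_asym: "acyclic E \<Longrightarrow> asym E"
  by (auto simp: acyclic_def intro!: asymI dest: trancl_into_trancl[OF r_into_trancl])

lemma asym_converse: "asym A \<Longrightarrow> asym (A\<inverse>)"
  by (auto intro!: asymI dest: asymD)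

text \<open>Acyclicity excludes antiparallel arcs, so having the right underlying undirected graph
  already makes \<open>E\<close> a reorientation, with \<open>A - E\<close> as the reversed set.
  This form is symmetric in \<open>A\<close> and its converse.\<close>

lemma carrier_AR:
  assumes "asym A"
  shows "carrier (AR A) = {E. acyclic E \<and> E \<union> E\<inverse> = A \<union> A\<inverse>}"
proof -
  have "reorientation A E \<longleftrightarrow> E \<union> E\<inverse> = A \<union> A\<inverse>" if "acyclic E" for E
  proof
    assume "reorientation A E"
    then obtain B where "B \<subseteq> A" "E = (A - B) \<union> B\<inverse>" by (auto simp: reorientation_def)
    then show "E \<union> E\<inverse> = A \<union> A\<inverse>" by auto
  next
    assume *: "E \<union> E\<inverse> = A \<union> A\<inverse>"
    have "E = (A - (A - E)) \<union> (A - E)\<inverse>"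
    proof (intro equalityI subrelI)
      fix x y assume "(x, y) \<in> E"
      moreover from this have "(y, x) \<notin> E" using acyclic_imp_asym[OF that] by (meson asymD)
      ultimately show "(x, y) \<in> (A - (A - E)) \<union> (A - E)\<inverse>" using * by blast
    next
      fix x y assume "(x, y) \<in> (A - (A - E)) \<union> (A - E)\<inverse>"
      then show "(x, y) \<in> E" using * by blast
    qed
    then show "reorientation A E" unfolding reorientation_def by blast
  qed
  then show ?thesis by (auto simp: AR_def)
qed

lemma le_AR: "E \<sqsubseteq>\<^bsub>AR A\<^esub> F \<longleftrightarrow> A \<inter> F \<subseteq> E"
  by (auto simp: AR_def)

lemma AR_orient:
  assumes "asym A" "E \<in> carrier (AR A)" "(x, y) \<in> A \<union> A\<inverse>"
  shows "(x, y) \<in> E \<longleftrightarrow> (y, x) \<notin> E"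
proof -
  have "asym E" "E \<union> E\<inverse> = A \<union> A\<inverse>"
    using assms by (auto simp: carrier_AR acyclic_imp_asym)
  then show ?thesis using assms(3) by (blast dest: asymD)
qed

lemma AR_subset: "asym A \<Longrightarrow> E \<in> carrier (AR A) \<Longrightarrow> E \<subseteq> A \<union> A\<inverse>"
  by (auto simp: carrier_AR)

lemma AR_converse: "asym A \<Longrightarrow> E \<in> carrier (AR (A\<inverse>)) \<longleftrightarrow> E \<in> carrier (AR A)"
  by (simp add: carrier_AR asym_converse Un_commute)

lemma AR_carrier_converse: "asym A \<Longrightarrow> carrier (AR (A\<inverse>)) = carrier (AR A)"
  using AR_converse by blast

lemma AR_converse': "asym A \<Longrightarrow> E\<inverse> \<in> carrier (AR A) \<longleftrightarrow> E \<in> carrier (AR A)"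
  by (simp add: carrier_AR Un_commute)

lemma partial_order_AR:
  assumes "asym A"
  shows "partial_order (AR A)"
proof
  fix E F assume *: "E \<sqsubseteq>\<^bsub>AR A\<^esub> F" "F \<sqsubseteq>\<^bsub>AR A\<^esub> E" "E \<in> carrier (AR A)" "F \<in> carrier (AR A)"
  have "(x, y) \<in> E \<longleftrightarrow> (x, y) \<in> F" for x y
    using *(1,2) AR_orient[OF assms *(3), of x y] AR_orient[OF assms *(4), of x y]
      AR_subset[OF assms *(3)] AR_subset[OF assms *(4)]
    unfolding le_AR by blast
  then show "E .=\<^bsub>AR A\<^esub> F" by (auto simp: AR_def)
qed (auto simp: AR_def)

text \<open>By \<open>le_AR\<close>, the inclusion of \<open>A \<inter> G\<close> in
  \<open>H\<close> says that \<open>H\<close> is below \<open>G\<close>. So \<open>H\<close> is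
  below \<open>G\<close> if and only if both \<open>E\<close> and \<open>F\<close> are, the
  universal property of the join.\<close>

definition has_joins :: "arcs \<Rightarrow> bool" where
  "has_joins A \<longleftrightarrow> (\<forall>E \<in> carrier (AR A). \<forall>F \<in> carrier (AR A). \<exists>H \<in> carrier (AR A).
     \<forall>G \<in> carrier (AR A). A \<inter> G \<subseteq> H \<longleftrightarrow> A \<inter> G \<subseteq> E \<inter> F)"

lemma has_joinsD:
  assumes "has_joins A" "E \<in> carrier (AR A)" "F \<in> carrier (AR A)"
  shows "\<exists>H \<in> carrier (AR A). \<forall>G \<in> carrier (AR A). A \<inter> G \<subseteq> H \<longleftrightarrow> A \<inter> G \<subseteq> E \<inter> F"
  using assms unfolding has_joins_def by blast

text \<open>Reversing every arc of digraph and reorientation alike is an isomorphism between the two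
  orders.\<close>

lemma has_joins_converse:
  assumes "asym A" "has_joins (A\<inverse>)"
  shows "has_joins A"
  unfolding has_joins_def
proof (intro ballI)
  fix E F assume "E \<in> carrier (AR A)" "F \<in> carrier (AR A)"
  then have "E\<inverse> \<in> carrier (AR (A\<inverse>))" "F\<inverse> \<in> carrier (AR (A\<inverse>))"
    using assms(1) by (simp_all add: AR_converse AR_converse')
  from has_joinsD[OF assms(2) this] obtain H where H: "H \<in> carrier (AR (A\<inverse>))"
    and *: "\<forall>G \<in> carrier (AR (A\<inverse>)). A\<inverse> \<inter> G \<subseteq> H \<longleftrightarrow> A\<inverse> \<inter> G \<subseteq> E\<inverse> \<inter> F\<inverse>"
    by (elim bexE)
  have "A \<inter> G \<subseteq> H\<inverse> \<longleftrightarrow> A \<inter> G \<subseteq> E \<inter> F" if "G \<in> carrier (AR A)" for G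
  proof -
    have "A\<inverse> \<inter> G\<inverse> \<subseteq> H \<longleftrightarrow> A\<inverse> \<inter> G\<inverse> \<subseteq> E\<inverse> \<inter> F\<inverse>"
      using that assms(1) by (intro *[rule_format]) (simp add: AR_converse AR_converse')
    moreover have "A\<inverse> \<inter> G\<inverse> \<subseteq> X \<longleftrightarrow> A \<inter> G \<subseteq> X\<inverse>" for X by auto
    ultimately show ?thesis by (metis converse_Int converse_converse)
  qed
  then show "\<exists>H \<in> carrier (AR A). \<forall>G \<in> carrier (AR A). A \<inter> G \<subseteq> H \<longleftrightarrow> A \<inter> G \<subseteq> E \<inter> F"
    using H assms(1) by (intro bexI[of _ "H\<inverse>"] ballI) (simp_all add: AR_converse AR_converse')
qed

text \<open>
  \<open>AR (A\<inverse>)\<close> has the same elements as \<open>AR A\<close> and the dual order, so that joins in both give a lattice.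
\<close>

lemma lattice_AR:
  assumes "asym A" "has_joins A"
  shows "lattice (AR A)"
proof -
  interpret partial_order "AR A" using assms(1) by (rule partial_order_AR)
  \<comment> \<open>A reorientation contains exactly one direction of each arc, so replacing arcs by
    their reversals negates both memberships, and contraposition swaps the roles of \<open>G\<close>
    and \<open>H\<close>.\<close>
  have dual: "A\<inverse> \<inter> G \<subseteq> H \<longleftrightarrow> A \<inter> H \<subseteq> G" if G: "G \<in> carrier (AR A)" and H: "H \<in> carrier (AR A)" for G H
  proof -
    have "((y, x) \<in> G \<longrightarrow> (y, x) \<in> H) \<longleftrightarrow> ((x, y) \<in> H \<longrightarrow> (x, y) \<in> G)" if "(x, y) \<in> A" for x y
      using AR_orient[OF assms(1) G, of x y] AR_orient[OF assms(1) H, of x y] that by auto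
    then have "(\<forall>x y. (x, y) \<in> A \<longrightarrow> (y, x) \<in> G \<longrightarrow> (y, x) \<in> H) \<longleftrightarrow>
      (\<forall>x y. (x, y) \<in> A \<longrightarrow> (x, y) \<in> H \<longrightarrow> (x, y) \<in> G)" by simp
    moreover have "A\<inverse> \<inter> G \<subseteq> H \<longleftrightarrow> (\<forall>x y. (x, y) \<in> A \<longrightarrow> (y, x) \<in> G \<longrightarrow> (y, x) \<in> H)" by blast
    moreover have "A \<inter> H \<subseteq> G \<longleftrightarrow> (\<forall>x y. (x, y) \<in> A \<longrightarrow> (x, y) \<in> H \<longrightarrow> (x, y) \<in> G)" by auto
    ultimately show ?thesis by simp
  qed
  show ?thesis
  proof
    fix E F assume EF: "E \<in> carrier (AR A)" "F \<in> carrier (AR A)"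
    then obtain H where H: "H \<in> carrier (AR A)"
      and *: "\<forall>G \<in> carrier (AR A). A \<inter> G \<subseteq> H \<longleftrightarrow> A \<inter> G \<subseteq> E \<inter> F"
      using has_joinsD[OF assms(2) EF] by meson
    have "least (AR A) H (Upper (AR A) {E, F})"
      using H EF * by (intro least_UpperI) (auto simp: le_AR Upper_def)
    then show "\<exists>s. least (AR A) s (Upper (AR A) {E, F})" by blast
  next
    fix E F assume EF: "E \<in> carrier (AR A)" "F \<in> carrier (AR A)"
    have "has_joins (A\<inverse>)"
      by (rule has_joins_converse) (use assms in \<open>simp_all add: asym_converse\<close>)
    from has_joinsD[OF this, unfolded AR_carrier_converse[OF assms(1)], OF EF]
    obtain H where H: "H \<in> carrier (AR A)"
      and *: "\<forall>G \<in> carrier (AR A). A\<inverse> \<inter> G \<subseteq> H \<longleftrightarrow> A\<inverse> \<inter> G \<subseteq> E \<inter> F"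
      by (elim bexE)
    have "G \<sqsubseteq>\<^bsub>AR A\<^esub> H \<longleftrightarrow> G \<sqsubseteq>\<^bsub>AR A\<^esub> E \<and> G \<sqsubseteq>\<^bsub>AR A\<^esub> F" if "G \<in> carrier (AR A)" for G
      using bspec[OF * that] dual[OF that H] dual[OF that EF(1)] dual[OF that EF(2)]
      unfolding le_AR by simp
    then have "greatest (AR A) H (Lower (AR A) {E, F})"
      using H EF by (intro greatest_LowerI) (auto simp: Lower_def)
    then show "\<exists>s. greatest (AR A) s (Lower (AR A) {E, F})" by blast
  qed
qed


subsection \<open>Adding a simplicial vertex\<close>

lemma asym_induced: "asym A \<Longrightarrow> asym (induced n A)"
  by (auto simp: induced_def intro!: asymI dest: asymD)

locale simplicial_extension =
  fixes n :: nat and A :: arcs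
  assumes digraph: "digraph_on (Suc n) A"
    and source_or_sink: "is_source A (Suc n) \<or> is_sink A (Suc n)"
    and simplicial: "simplicial A (Suc n)"
begin

abbreviation "L \<equiv> AR A"
abbreviation "M \<equiv> AR (induced n A)"

lemma asym_A: "asym A"
  and A_subset: "A \<subseteq> {1..Suc n} \<times> {1..Suc n}"
  using digraph by (auto simp: digraph_on_def)

lemma asym_M: "asym (induced n A)"
  using asym_A by (rule asym_induced)

lemma carrier_L_subset: "F \<in> carrier L \<Longrightarrow> F \<subseteq> {1..Suc n} \<times> {1..Suc n}"
  using AR_subset[OF asym_A] A_subset by blast

lemma carrier_M_subset: "E \<in> carrier M \<Longrightarrow> E \<subseteq> {1..n} \<times> {1..n}"
  using AR_subset[OF asym_M] by (fastforce simp: induced_def)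

lemma mem_induced_iff: "(x, y) \<in> induced n F \<longleftrightarrow> (x, y) \<in> F \<and> x \<in> {1..n} \<and> y \<in> {1..n}"
  by (auto simp: induced_def)

lemma nbr_range:
  assumes "F \<in> carrier L"
  shows "(x, Suc n) \<in> F \<Longrightarrow> x \<in> {1..n}" "(Suc n, x) \<in> F \<Longrightarrow> x \<in> {1..n}"
proof -
  have "(Suc n, Suc n) \<notin> F"
    using assms acyclic_imp_asym by (auto simp: carrier_AR[OF asym_A] dest: asymD)
  then show "(x, Suc n) \<in> F \<Longrightarrow> x \<in> {1..n}" "(Suc n, x) \<in> F \<Longrightarrow> x \<in> {1..n}"
    using carrier_L_subset[OF assms] by (auto simp: le_Suc_eq)
qed

lemma nbrs_adjacent:
  assumes "(Suc n, x) \<in> A \<union> A\<inverse>" "(Suc n, y) \<in> A \<union> A\<inverse>" "x \<noteq> y"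
  shows "(x, y) \<in> A \<union> A\<inverse>"
  using simplicial assms by (auto simp: simplicial_def)

lemma induced_closed:
  assumes "F \<in> carrier L"
  shows "induced n F \<in> carrier M"
proof -
  have "induced n F \<subseteq> F" by (auto simp: induced_def)
  then have "acyclic (induced n F)"
    using assms acyclic_subset by (auto simp: carrier_AR[OF asym_A])
  moreover have "induced n F \<union> (induced n F)\<inverse> = induced n (F \<union> F\<inverse>)"
    by (auto simp: induced_def)
  moreover have "induced n A \<union> (induced n A)\<inverse> = induced n (A \<union> A\<inverse>)"
    by (auto simp: induced_def)
  ultimately show ?thesis
    using assms by (auto simp: carrier_AR[OF asym_A] carrier_AR[OF asym_M])
qed

text \<open>The two neighbors are adjacent because the vertex is simplicial, and the arc from
  \<open>y\<close> to \<open>x\<close> would close a directed triangle.\<close>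

lemma transitive_at_vertex:
  assumes F: "F \<in> carrier L" and xy: "(x, Suc n) \<in> F" "(Suc n, y) \<in> F"
  shows "(x, y) \<in> F"
proof -
  have ac: "acyclic F" and eq: "F \<union> F\<inverse> = A \<union> A\<inverse>"
    using F by (auto simp: carrier_AR[OF asym_A])
  have "x \<noteq> y" using acyclic_imp_asym[OF ac] xy by (auto dest: asymD)
  then have "(x, y) \<in> A \<union> A\<inverse>" using xy eq nbrs_adjacent[of x y] by blast
  moreover have "(y, x) \<notin> F"
  proof
    assume "(y, x) \<in> F"
    then have "(y, y) \<in> F\<^sup>+" using xy by (meson trancl.simps)
    then show False using ac by (simp add: acyclic_def)
  qed
  ultimately show ?thesis using eq by blast
qed

text \<open>
  For acyclicity, order the vertices by levels: first those from which an in-neighbor of the new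
  vertex can be reached, then the new vertex, then the rest.
\<close>

lemma extension_closed:
  assumes E: "induced n F \<in> carrier M" and asym: "asym F" and eq: "F \<union> F\<inverse> = A \<union> A\<inverse>"
    and tr: "\<And>x y. (x, Suc n) \<in> F \<Longrightarrow> (Suc n, y) \<in> F \<Longrightarrow> (x, y) \<in> F"
  shows "F \<in> carrier L"
proof -
  let ?E = "induced n F"
  have acE: "acyclic ?E" using E by (auto simp: carrier_AR[OF asym_M])
  have finE: "finite ?E" by (auto simp: induced_def)
  have F_sub: "F \<subseteq> {1..Suc n} \<times> {1..Suc n}" using eq A_subset by blast
  have loop: "(Suc n, Suc n) \<notin> F" using asym by (auto dest: asymD)
  define P where "P = {a. \<exists>x. (x, Suc n) \<in> F \<and> (a, x) \<in> ?E\<^sup>*}"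
  define level where "level a = (if a = Suc n then 1 else if a \<in> P then 0 else 2 :: nat)" for a
  \<comment> \<open>Out-neighbors of the new vertex avoid the lowest level: the arc from
    \<open>x\<close> to \<open>y\<close> supplied by \<open>tr\<close> would otherwise close a cycle
    in \<open>?E\<close>.\<close>
  have out: "y \<notin> P" if y: "(Suc n, y) \<in> F" for y
  proof
    assume "y \<in> P"
    then obtain x where x: "(x, Suc n) \<in> F" and yx: "(y, x) \<in> ?E\<^sup>*" by (auto simp: P_def)
    have "x \<noteq> Suc n" "y \<noteq> Suc n" using x y loop by auto
    then have "(x, y) \<in> ?E" using tr[OF x y] F_sub by (auto simp: mem_induced_iff le_Suc_eq)
    then have "(x, x) \<in> ?E\<^sup>+" using yx by (rule rtrancl_into_trancl2)
    then show False using acE by (simp add: acyclic_def)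
  qed
  have "F \<subseteq> inv_image (less_than <*lex*> ?E) (\<lambda>a. (level a, a))"
  proof (rule subrelI)
    fix a b assume ab: "(a, b) \<in> F"
    consider "b = Suc n" | "a = Suc n" | "a \<noteq> Suc n" "b \<noteq> Suc n" by blast
    then show "(a, b) \<in> inv_image (less_than <*lex*> ?E) (\<lambda>a. (level a, a))"
    proof cases
      case 1
      then have "a \<in> P" "a \<noteq> Suc n" using ab loop by (auto simp: P_def)
      with 1 show ?thesis by (simp add: level_def)
    next
      case 2
      then have "b \<notin> P" "b \<noteq> Suc n" using ab out loop by auto
      with 2 show ?thesis by (simp add: level_def)
    next
      case 3
      then have "(a, b) \<in> ?E" using ab F_sub by (auto simp: mem_induced_iff le_Suc_eq)
      moreover from this have "b \<in> P \<Longrightarrow> a \<in> P"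
        by (auto simp: P_def intro: converse_rtrancl_into_rtrancl)
      ultimately show ?thesis using 3 by (auto simp: level_def)
    qed
  qed
  moreover have "wf (inv_image (less_than <*lex*> ?E) (\<lambda>a. (level a, a)))"
    using finite_acyclic_wf[OF finE acE] by (intro wf_inv_image wf_lex_prod wf_less_than)
  ultimately have "acyclic F" by (meson wf_subset wf_acyclic)
  then show ?thesis using eq by (simp add: carrier_AR[OF asym_A])
qed

lemma Int_subset_split:
  "A \<inter> G \<subseteq> X \<longleftrightarrow> induced n A \<inter> induced n G \<subseteq> induced n X \<and>
    (\<forall>u v. (u, v) \<in> A \<and> (u = Suc n \<or> v = Suc n) \<and> (u, v) \<in> G \<longrightarrow> (u, v) \<in> X)" (is "_ \<longleftrightarrow> ?low \<and> ?new")
proof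
  assume "A \<inter> G \<subseteq> X"
  then show "?low \<and> ?new" by (auto simp: mem_induced_iff)
next
  assume *: "?low \<and> ?new"
  show "A \<inter> G \<subseteq> X"
  proof (rule subrelI)
    fix u v assume "(u, v) \<in> A \<inter> G"
    then have uv: "(u, v) \<in> A" "(u, v) \<in> G" by auto
    show "(u, v) \<in> X"
    proof (cases "u = Suc n \<or> v = Suc n")
      case True
      with uv * show ?thesis by blast
    next
      case False
      have "u \<in> {1..Suc n}" "v \<in> {1..Suc n}" using uv A_subset by blast+
      with False have "u \<in> {1..n}" "v \<in> {1..n}" by auto
      then have "(u, v) \<in> induced n A \<inter> induced n G" using uv by (simp add: mem_induced_iff)
      then have "(u, v) \<in> induced n X" using * by blast
      then show ?thesis by (simp add: mem_induced_iff)
    qed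
  qed
qed

lemma A_split: "A = induced n A \<union> {(u, v) \<in> A. u = Suc n \<or> v = Suc n}"
  using A_subset by (auto simp: mem_induced_iff le_Suc_eq)

text \<open>For a source, reversing an arc turns an out-neighbor into an in-neighbor. The join must
  have all in-neighbors \<open>I\<close> of \<open>E\<close> and \<open>F\<close>, must restrict to
  the join \<open>H0\<close> of the restrictions, and among the clique of neighbors its in-neighbors
  must be closed under \<open>H0\<close>-predecessors. Taking no more than this closure gives an
  acyclic digraph; the point to check is that the closure is forced in every upper bound.\<close>

lemma has_joins_source:
  assumes "is_source A (Suc n)" "has_joins (induced n A)"
  shows "has_joins A"
  unfolding has_joins_def
proof (intro ballI)
  fix E F assume E: "E \<in> carrier L" and F: "F \<in> carrier L"
  obtain H0 where H0: "H0 \<in> carrier M"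
    and join: "\<forall>G \<in> carrier M.
      induced n A \<inter> G \<subseteq> H0 \<longleftrightarrow> induced n A \<inter> G \<subseteq> induced n E \<inter> induced n F"
    using has_joinsD[OF assms(2) induced_closed[OF E] induced_closed[OF F]] by meson
  define nb where "nb = {x. (Suc n, x) \<in> A}"
  define I where "I = {x. (x, Suc n) \<in> E \<union> F}"
  \<comment> \<open>One step back from \<open>I\<close> suffices: \<open>H0\<close> is transitive on
    the clique of neighbors, so \<open>K\<close> is already closed under predecessors there.\<close>
  define K where "K = {x \<in> nb. x \<in> I \<or> (\<exists>y \<in> I. (x, y) \<in> H0)}"
  define H where "H = H0 \<union> K \<times> {Suc n} \<union> {Suc n} \<times> (nb - K)"
  have no_in: "(x, Suc n) \<notin> A" for x
    using assms(1) by (auto simp: is_source_def)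
  have nb_range: "nb \<subseteq> {1..n}"
  proof
    fix x assume "x \<in> nb"
    then have x: "(Suc n, x) \<in> A" by (simp add: nb_def)
    then have "x \<noteq> Suc n" using no_in by blast
    moreover have "x \<in> {1..Suc n}" using x A_subset by blast
    ultimately show "x \<in> {1..n}" by auto
  qed
  have I_nb: "I \<subseteq> nb"
    using AR_subset[OF asym_A E] AR_subset[OF asym_A F] no_in by (auto simp: I_def nb_def)
  have H0_sub: "H0 \<subseteq> {1..n} \<times> {1..n}" using H0 by (rule carrier_M_subset)
  have new: "Suc n \<notin> nb" "Suc n \<notin> K" "(x, Suc n) \<notin> H0" "(Suc n, x) \<notin> H0" for x
    using nb_range H0_sub by (auto simp: K_def)
  have H0_asym: "asym H0" and H0_eq: "H0 \<union> H0\<inverse> = induced n A \<union> (induced n A)\<inverse>"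
    using H0 acyclic_imp_asym by (auto simp: carrier_AR[OF asym_M])
  have H0_tot: "(x, y) \<in> H0 \<or> (y, x) \<in> H0" if "x \<in> nb" "y \<in> nb" "x \<noteq> y" for x y
  proof -
    have "(x, y) \<in> A \<union> A\<inverse>" using nbrs_adjacent[of x y] that by (simp add: nb_def)
    moreover have "x \<in> {1..n}" "y \<in> {1..n}" using that nb_range by blast+
    ultimately have "(x, y) \<in> H0 \<union> H0\<inverse>" unfolding H0_eq by (simp add: mem_induced_iff)
    then show ?thesis by simp
  qed
  have H0_tr: "(x, z) \<in> H0" if "(x, y) \<in> H0" "(y, z) \<in> H0" "x \<in> nb" "z \<in> nb" for x y z
  proof -
    have "acyclic H0" using H0 by (auto simp: carrier_AR[OF asym_M])
    moreover have "(x, z) \<in> H0\<^sup>+" using that by auto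
    ultimately have "x \<noteq> z" "(z, x) \<notin> H0"
      by (auto simp: acyclic_def) (meson trancl.trancl_into_trancl)
    then show ?thesis using H0_tot that by blast
  qed
  have ind_H: "induced n H = H0"
    using H0_sub by (auto simp: H_def mem_induced_iff)
  have H: "H \<in> carrier L"
  proof (rule extension_closed)
    show "induced n H \<in> carrier M" using H0 ind_H by simp
    show "asym H"
      using H0_asym H0_sub nb_range by (auto simp: H_def K_def intro!: asymI dest: asymD)
    have "A \<union> A\<inverse> = (induced n A \<union> (induced n A)\<inverse>) \<union> nb \<times> {Suc n} \<union> {Suc n} \<times> nb"
      using A_split no_in by (auto simp: nb_def)
    then show "H \<union> H\<inverse> = A \<union> A\<inverse>"
      unfolding H0_eq[symmetric] by (auto simp: H_def K_def)
    fix x y assume "(x, Suc n) \<in> H" "(Suc n, y) \<in> H"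
    then have x: "x \<in> K" and y: "y \<in> nb" "y \<notin> K"
      using new by (simp_all add: H_def)
    have "(x, y) \<in> H0"
    proof (rule ccontr)
      assume "(x, y) \<notin> H0"
      then have yx: "(y, x) \<in> H0" using x y H0_tot[of x y] by (auto simp: K_def)
      show False
      proof (cases "x \<in> I")
        case True
        then show False using yx y by (auto simp: K_def)
      next
        case False
        then obtain z where "z \<in> I" "(x, z) \<in> H0" using x by (auto simp: K_def)
        then have "(y, z) \<in> H0" using H0_tr yx y I_nb by blast
        then show False using \<open>z \<in> I\<close> y by (auto simp: K_def)
      qed
    qed
    then show "(x, y) \<in> H" by (simp add: H_def)
  qed
  have "A \<inter> G \<subseteq> H \<longleftrightarrow> A \<inter> G \<subseteq> E \<inter> F" if G: "G \<in> carrier L" for G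
  proof -
    have split: "A \<inter> G \<subseteq> X \<longleftrightarrow>
      induced n A \<inter> induced n G \<subseteq> induced n X \<and> (\<forall>x \<in> nb. (Suc n, x) \<in> G \<longrightarrow> (Suc n, x) \<in> X)" for X
      unfolding Int_subset_split using no_in by (auto simp: nb_def)
    have low: "induced n A \<inter> induced n G \<subseteq> induced n H \<longleftrightarrow>
      induced n A \<inter> induced n G \<subseteq> induced n (E \<inter> F)"
      using bspec[OF join induced_closed[OF G]] unfolding ind_H by (auto simp: induced_def)
    have EF: "(Suc n, x) \<in> E \<inter> F \<longleftrightarrow> x \<notin> I" if "x \<in> nb" for x
      using AR_orient[OF asym_A E, of "Suc n" x] AR_orient[OF asym_A F, of "Suc n" x] that
      by (auto simp: I_def nb_def)
    \<comment> \<open>An upper bound \<open>G\<close> keeps the arc to \<open>x\<close>, while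
      \<open>y\<close> in \<open>I\<close> is an in-neighbor, so \<open>G\<close> has the arc from
      \<open>y\<close> to \<open>x\<close>, against \<open>H0\<close>. Then the arc of
      \<open>A\<close> goes from \<open>x\<close> to \<open>y\<close> and is kept in
      \<open>H0\<close>.\<close>
    have "(Suc n, x) \<in> H"
      if x: "x \<in> nb" "(Suc n, x) \<in> G" and notI: "\<forall>x \<in> nb. (Suc n, x) \<in> G \<longrightarrow> x \<notin> I"
        and GH: "induced n A \<inter> induced n G \<subseteq> H0" for x
    proof (rule ccontr)
      assume "(Suc n, x) \<notin> H"
      then have "x \<in> K" using x by (auto simp: H_def)
      then obtain y where y: "y \<in> I" "(x, y) \<in> H0" using x notI by (auto simp: K_def)
      then have ynb: "y \<in> nb" using I_nb by blast
      then have "(y, Suc n) \<in> G"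
        using y notI AR_orient[OF asym_A G, of "Suc n" y] by (auto simp: nb_def)
      then have "(y, x) \<in> induced n G"
        using transitive_at_vertex[OF G] x ynb nb_range by (auto simp: mem_induced_iff)
      moreover have "(y, x) \<notin> H0" using y H0_asym by (auto dest: asymD)
      ultimately have "(y, x) \<notin> induced n A" using GH by blast
      then have "(x, y) \<in> induced n A" using y H0_eq by blast
      \<comment> \<open>Instantiating the property of the join with \<open>H0\<close> itself: arcs
        kept in the join are kept in both operands. The operand in which \<open>y\<close> is an
        in-neighbor then contains both directions of this arc.\<close>
      then have xyEF: "(x, y) \<in> E" "(x, y) \<in> F" using y bspec[OF join H0] by (auto simp: induced_def)
      have "(y, x) \<in> X" if "X \<in> carrier L" "(y, Suc n) \<in> X" "(x, Suc n) \<notin> X" for X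
        using transitive_at_vertex[OF that(1,2)] AR_orient[OF asym_A that(1), of "Suc n" x] that(3) x
        by (auto simp: nb_def)
      moreover have "(x, Suc n) \<notin> E" "(x, Suc n) \<notin> F" using x notI by (auto simp: I_def)
      moreover have "asym E" "asym F"
        using E F acyclic_imp_asym by (auto simp: carrier_AR[OF asym_A])
      ultimately show False using y(1) xyEF E F by (auto simp: I_def dest: asymD)
    qed
    moreover have "x \<notin> I" if "x \<in> nb" "(Suc n, x) \<in> H" for x
      using that new by (auto simp: H_def K_def)
    ultimately show ?thesis
      unfolding split low using EF ind_H low by blast
  qed
  then show "\<exists>H \<in> carrier L. \<forall>G \<in> carrier L. A \<inter> G \<subseteq> H \<longleftrightarrow> A \<inter> G \<subseteq> E \<inter> F"
    using H by (intro bexI[of _ H] ballI)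
qed

section \<open>The ends of a rail as adjoints of restriction\<close>

lemma add_kept_closed:
  assumes "E \<in> carrier M"
  shows "add_kept n A E \<in> carrier L" "induced n (add_kept n A E) = E"
proof -
  have sub: "E \<subseteq> {1..n} \<times> {1..n}" using assms by (rule carrier_M_subset)
  show ind: "induced n (add_kept n A E) = E"
    using sub by (auto simp: add_kept_def induced_def)
  have E: "asym E" "E \<union> E\<inverse> = induced n A \<union> (induced n A)\<inverse>"
    using assms acyclic_imp_asym by (auto simp: carrier_AR[OF asym_M])
  show "add_kept n A E \<in> carrier L"
  proof (rule extension_closed)
    show "asym (add_kept n A E)"
      using E(1) asym_A sub unfolding add_kept_def by (fastforce intro!: asymI dest: asymD)
    show "add_kept n A E \<union> (add_kept n A E)\<inverse> = A \<union> A\<inverse>"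
      using E(2) A_split unfolding add_kept_def by blast
    show "(x, y) \<in> add_kept n A E"
      if "(x, Suc n) \<in> add_kept n A E" "(Suc n, y) \<in> add_kept n A E" for x y
      using that source_or_sink sub by (auto simp: add_kept_def is_source_def is_sink_def)
  qed (use ind assms in simp)
qed

lemma add_reversed_closed:
  assumes "E \<in> carrier M"
  shows "add_reversed n A E \<in> carrier L" "induced n (add_reversed n A E) = E"
proof -
  have sub: "E \<subseteq> {1..n} \<times> {1..n}" using assms by (rule carrier_M_subset)
  show ind: "induced n (add_reversed n A E) = E"
    using sub by (auto simp: add_reversed_def induced_def)
  have E: "asym E" "E \<union> E\<inverse> = induced n A \<union> (induced n A)\<inverse>"
    using assms acyclic_imp_asym by (auto simp: carrier_AR[OF asym_M])
  show "add_reversed n A E \<in> carrier L"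
  proof (rule extension_closed)
    show "asym (add_reversed n A E)"
      using E(1) asym_A sub unfolding add_reversed_def by (fastforce intro!: asymI dest: asymD)
    show "add_reversed n A E \<union> (add_reversed n A E)\<inverse> = A \<union> A\<inverse>"
      using E(2) A_split unfolding add_reversed_def by blast
    show "(x, y) \<in> add_reversed n A E"
      if "(x, Suc n) \<in> add_reversed n A E" "(Suc n, y) \<in> add_reversed n A E" for x y
      using that source_or_sink sub by (auto simp: add_reversed_def is_source_def is_sink_def)
  qed (use ind assms in simp)
qed

lemma le_L_iff:
  assumes "E \<in> carrier L" "F \<in> carrier L"
  shows "E \<sqsubseteq>\<^bsub>L\<^esub> F \<longleftrightarrow> induced n E \<sqsubseteq>\<^bsub>M\<^esub> induced n F \<and>
    (\<forall>(u, v) \<in> A. (u = Suc n \<or> v = Suc n) \<and> (u, v) \<in> F \<longrightarrow> (u, v) \<in> E)"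
  unfolding le_AR Int_subset_split by auto

lemma mem_add_kept:
  assumes "E \<in> carrier M"
  shows "(u, v) \<in> add_kept n A E \<longleftrightarrow> (if u = Suc n \<or> v = Suc n then (u, v) \<in> A else (u, v) \<in> E)"
  using carrier_M_subset[OF assms] by (auto simp: add_kept_def)

lemma mem_add_reversed:
  assumes "E \<in> carrier M"
  shows "(u, v) \<in> add_reversed n A E \<longleftrightarrow>
    (if u = Suc n \<or> v = Suc n then (v, u) \<in> A else (u, v) \<in> E)"
  using carrier_M_subset[OF assms] by (auto simp: add_reversed_def)

lemma add_kept_le_iff:
  assumes "E \<in> carrier M" "F \<in> carrier L"
  shows "add_kept n A E \<sqsubseteq>\<^bsub>L\<^esub> F \<longleftrightarrow> E \<sqsubseteq>\<^bsub>M\<^esub> induced n F"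
  unfolding le_L_iff[OF add_kept_closed(1)[OF assms(1)] assms(2)] add_kept_closed(2)[OF assms(1)]
  using mem_add_kept[OF assms(1)] by auto

lemma le_add_reversed_iff:
  assumes "E \<in> carrier M" "F \<in> carrier L"
  shows "F \<sqsubseteq>\<^bsub>L\<^esub> add_reversed n A E \<longleftrightarrow> induced n F \<sqsubseteq>\<^bsub>M\<^esub> E"
  unfolding le_L_iff[OF assms(2) add_reversed_closed(1)[OF assms(1)]] add_reversed_closed(2)[OF assms(1)]
  using mem_add_reversed[OF assms(1)] asym_A by (auto dest: asymD)

lemma eq_extension:
  assumes "F \<in> carrier L" "G \<in> carrier L" "induced n F = induced n G"
    and "\<And>u v. (u, v) \<in> A \<Longrightarrow> u = Suc n \<or> v = Suc n \<Longrightarrow> (u, v) \<in> F \<longleftrightarrow> (u, v) \<in> G"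
  shows "F = G"
proof -
  interpret partial_order L using asym_A by (rule partial_order_AR)
  interpret M: partial_order M using asym_M by (rule partial_order_AR)
  show ?thesis
    by (rule le_antisym) (use assms induced_closed[OF assms(2)] in \<open>auto simp: le_L_iff\<close>)
qed

lemma add_kept_down:
  assumes "E \<in> carrier M" "F \<in> carrier L" "F \<sqsubseteq>\<^bsub>L\<^esub> add_kept n A E"
  shows "add_kept n A (induced n F) = F"
proof (rule eq_extension)
  note M = induced_closed[OF assms(2)]
  show "add_kept n A (induced n F) \<in> carrier L" "F \<in> carrier L"
    "induced n (add_kept n A (induced n F)) = induced n F"
    using add_kept_closed[OF M] assms(2) by simp_all
  fix u v assume "(u, v) \<in> A" "u = Suc n \<or> v = Suc n"
  moreover from this have "(u, v) \<in> F"
    using assms(3) mem_add_kept[OF assms(1), of u v] unfolding le_AR by auto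
  ultimately show "(u, v) \<in> add_kept n A (induced n F) \<longleftrightarrow> (u, v) \<in> F"
    by (simp add: mem_add_kept[OF M])
qed

lemma add_reversed_up:
  assumes "E \<in> carrier M" "F \<in> carrier L" "add_reversed n A E \<sqsubseteq>\<^bsub>L\<^esub> F"
  shows "add_reversed n A (induced n F) = F"
proof (rule eq_extension)
  note M = induced_closed[OF assms(2)]
  show "add_reversed n A (induced n F) \<in> carrier L" "F \<in> carrier L"
    "induced n (add_reversed n A (induced n F)) = induced n F"
    using add_reversed_closed[OF M] assms(2) by simp_all
  fix u v assume uv: "(u, v) \<in> A" "u = Suc n \<or> v = Suc n"
  then have "(v, u) \<notin> A" using asym_A by (auto dest: asymD)
  moreover from this uv have "(u, v) \<notin> F"
    using assms(3) mem_add_reversed[OF assms(1), of u v] unfolding le_AR by auto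
  ultimately show "(u, v) \<in> add_reversed n A (induced n F) \<longleftrightarrow> (u, v) \<in> F"
    using uv by (simp add: mem_add_reversed[OF M])
qed

end

section \<open>Lattices from peo-consistent labelings\<close>

lemma peo_consistent_SucD:
  assumes "digraph_on (Suc n) A" "peo_consistent (Suc n) A"
  shows "simplicial_extension n A" "digraph_on n (induced n A)" "peo_consistent n (induced n A)"
proof -
  \<comment> \<open>For a single vertex, \<open>peo_consistent\<close> states neither that it is a
    source or sink nor that it is simplicial; both hold because there are no arcs.\<close>
  have "A = {}" if "n = 0"
    using assms(1) that by (auto simp: digraph_on_def dest: asymD)
  then show "simplicial_extension n A" "peo_consistent n (induced n A)"
    using assms by (auto simp: simplicial_extension_def is_source_def simplicial_def)
  show "digraph_on n (induced n A)"
    using assms by (auto simp: digraph_on_def asym_induced) (auto simp: induced_def)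
qed

lemma induced_converse: "induced n (A\<inverse>) = (induced n A)\<inverse>"
  by (auto simp: induced_def)

lemma has_joins_peo_consistent:
  "digraph_on n A \<Longrightarrow> peo_consistent n A \<Longrightarrow> has_joins A"
proof (induction n arbitrary: A)
  case 0
  then have "A = {}" by (auto simp: digraph_on_def)
  then show ?case by (auto simp: has_joins_def)
next
  case (Suc n)
  note step = peo_consistent_SucD[OF Suc.prems]
  interpret simplicial_extension n A by (rule step)
  have IH: "has_joins (induced n A)" using Suc.IH step by blast
  show ?case
  proof (cases "is_source A (Suc n)")
    case True
    then show ?thesis using IH by (rule has_joins_source)
  next
    case False
    \<comment> \<open>A new sink becomes a source in the reversed digraph, whose joins transfer back
      by \<open>has_joins_converse\<close>.\<close>
    then have "is_source (A\<inverse>) (Suc n)" using source_or_sink by (auto simp: is_source_def is_sink_def)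
    moreover have "simplicial_extension n (A\<inverse>)"
      using digraph simplicial calculation asym_converse[of A]
      by (auto simp: simplicial_extension_def digraph_on_def simplicial_def)
    moreover have "has_joins (induced n (A\<inverse>))"
      unfolding induced_converse
      by (rule has_joins_converse) (use IH asym_converse[OF asym_M] in simp_all)
    ultimately have "has_joins (A\<inverse>)" by (simp add: simplicial_extension.has_joins_source)
    then show ?thesis using has_joins_converse asym_A by blast
  qed
qed

lemma lattice_AR_peo_consistent:
  "digraph_on n A \<Longrightarrow> peo_consistent n A \<Longrightarrow> lattice (AR A)"
  using lattice_AR has_joins_peo_consistent by (auto simp: digraph_on_def)


section \<open>Algorithm J\<close>

text \<open>A segment of a run that starts after the visits \<open>us\<close>, with no claim about
  termination. Unlike \<open>algorithm_J_visits\<close> it recurses from the front, so that segments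
  can be lifted and concatenated.\<close>

primrec J_run :: "nat list set \<Rightarrow> nat list list \<Rightarrow> nat list list \<Rightarrow> bool" where
  "J_run L us [] \<longleftrightarrow> True"
| "J_run L us (v # vs) \<longleftrightarrow> algorithm_J_step L us v \<and> J_run L (us @ [v]) vs"

lemma J_run_append: "J_run L us (vs @ ws) \<longleftrightarrow> J_run L us vs \<and> J_run L (us @ vs) ws"
  by (induction vs arbitrary: us) auto

lemma J_run_visits:
  "algorithm_J_visits n L p us \<Longrightarrow> J_run L us vs \<Longrightarrow> algorithm_J_visits n L p (us @ vs)"
proof (induction vs arbitrary: us)
  case (Cons v vs)
  then show ?case using algorithm_J_visits.J2[of n L p us v] by fastforce
qed simp

text \<open>A step needs an unvisited permutation, so a run that exhausts \<open>L\<close> has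
  terminated.\<close>

lemma J_run_generates:
  assumes "L \<subseteq> permutations_of_set {1..n}" "p \<in> L" "J_run L [p] ps" "set (p # ps) = L"
  shows "algorithm_J_generates n L p (p # ps)"
  using J_run_visits[OF algorithm_J_visits.J1[OF assms(1,2)] assms(3)] assms(4)
  by (auto simp: algorithm_J_generates_def algorithm_J_step_def admissible_def)


subsection \<open>Jumps in a permutation extended by a new largest value\<close>

lemma insert_at_Suc: "insert_at (Suc i) x xs = take i xs @ x # drop i xs"
  by (simp add: insert_at_def)

lemma remove1_insert_at [simp]: "x \<notin> set xs \<Longrightarrow> remove1 x (insert_at (Suc i) x xs) = xs"
proof -
  assume "x \<notin> set xs"
  then have "x \<notin> set (take i xs)" by (meson in_set_takeD)
  then show ?thesis by (simp add: insert_at_Suc remove1_append)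
qed

lemma set_insert_at [simp]: "set (insert_at (Suc i) x xs) = insert x (set xs)"
  unfolding insert_at_Suc by simp (metis append_take_drop_id set_append)

lemma insert_at_inj:
  assumes "x \<notin> set xs" "i \<le> length xs" "j \<le> length xs"
  shows "insert_at (Suc i) x xs = insert_at (Suc j) x xs \<longleftrightarrow> i = j"
proof
  assume "insert_at (Suc i) x xs = insert_at (Suc j) x xs"
  moreover have "x \<notin> set (take i xs)" "x \<notin> set (take j xs)" "x \<notin> set (drop i xs)"
    using assms(1) by (meson in_set_takeD in_set_dropD)+
  ultimately have "take i xs = take j xs" by (simp add: insert_at_Suc append_Cons_eq_iff)
  then show "i = j" using assms(2,3) by (metis length_take min.absorb2)
qed simp

text \<open>The flag selects the border, \<open>True\<close> being the right one, so that both
  directions of the zigzag share their lemmas.\<close>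

definition extend :: "bool \<Rightarrow> 'a \<Rightarrow> 'a list \<Rightarrow> 'a list" where
  "extend b x xs = (if b then xs @ [x] else x # xs)"

lemma extend_insert_at: "extend b x xs = insert_at (Suc (if b then length xs else 0)) x xs"
  by (simp add: extend_def insert_at_def)

lemma remove1_extend [simp]: "x \<notin> set xs \<Longrightarrow> remove1 x (extend b x xs) = xs"
  by (simp add: extend_insert_at)

lemma set_jump: "jump dir p a d q \<Longrightarrow> a \<in> set p \<and> set q = set p"
  by (cases dir) auto

text \<open>Turns jumps of the largest value into arithmetic on insertion positions, counted from 0;
  direction and minimality are decided there.\<close>

lemma jump_new_iff:
  assumes less: "\<forall>x \<in> set p. x < a" and i: "i \<le> length p"
  shows "jump dir (insert_at (Suc i) a p) a d q \<longleftrightarrow>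
    (\<exists>k \<le> length p. q = insert_at (Suc k) a p \<and> k \<noteq> i \<and>
       dir = (if i < k then Rightward else Leftward) \<and> d = (k - i) + (i - k))"
    (is "?jump \<longleftrightarrow> ?rhs")
proof
  have notin: "a \<notin> set (take i p)" "a \<notin> set (drop i p)"
    using less by (meson in_set_takeD in_set_dropD less_irrefl)+
  assume ?jump
  show ?rhs
  proof (cases dir)
    case Rightward
    then obtain xs ys zs where *: "insert_at (Suc i) a p = xs @ a # ys @ zs"
      and q: "q = xs @ ys @ a # zs" and d: "length ys = d" "d > 0"
      using \<open>?jump\<close> by auto
    then have eq: "xs = take i p" "ys @ zs = drop i p"
      using notin by (simp_all add: insert_at_Suc append_Cons_eq_iff)
    then have p: "p = xs @ ys @ zs" by simp
    moreover have "length xs = i" using eq i by simp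
    ultimately show ?thesis
      using Rightward q d by (intro exI[of _ "i + d"]) (auto simp: insert_at_Suc)
  next
    case Leftward
    then obtain xs ys zs where *: "insert_at (Suc i) a p = (xs @ ys) @ a # zs"
      and q: "q = xs @ a # ys @ zs" and d: "length ys = d" "d > 0"
      using \<open>?jump\<close> by auto
    then have eq: "xs @ ys = take i p" "zs = drop i p"
      using notin unfolding insert_at_Suc by (metis append_Cons_eq_iff)+
    then have p: "p = xs @ ys @ zs" by (metis append.assoc append_take_drop_id)
    moreover have "i = length xs + d" using eq(1) i d by (metis length_append length_take min.absorb2)
    ultimately show ?thesis
      using Leftward q d by (intro exI[of _ "length xs"]) (auto simp: insert_at_Suc)
  qed
next
  assume ?rhs
  then obtain k where k: "k \<le> length p" "q = insert_at (Suc k) a p" "k \<noteq> i"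
    "dir = (if i < k then Rightward else Leftward)" "d = (k - i) + (i - k)" by blast
  show ?jump
  proof (cases "i < k")
    case True
    have "insert_at (Suc i) a p = take i p @ [a] @ take (k - i) (drop i p) @ drop k p"
      using True by (simp add: insert_at_Suc) (metis add.commute append_take_drop_id drop_drop le_add_diff_inverse2 less_imp_le)
    moreover have "q = take i p @ take (k - i) (drop i p) @ [a] @ drop k p"
      using True k(2) by (simp add: insert_at_Suc) (metis append.assoc le_add_diff_inverse less_imp_le take_add)
    moreover have "length (take (k - i) (drop i p)) = d" "d > 0" using k True by simp_all
    moreover have "\<forall>y \<in> set (take (k - i) (drop i p)). a > y"
      using less by (meson in_set_takeD in_set_dropD)
    moreover have "dir = Rightward" using k(4) True by simp
    ultimately show ?thesis by (simp only: jump.simps) blast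
  next
    case False
    then have ki: "k < i" using k(3) by simp
    have "q = take k p @ [a] @ take (i - k) (drop k p) @ drop i p"
      using ki k(2) by (simp add: insert_at_Suc) (metis add.commute append_take_drop_id drop_drop le_add_diff_inverse2 less_imp_le)
    moreover have "insert_at (Suc i) a p = take k p @ take (i - k) (drop k p) @ [a] @ drop i p"
      using ki by (simp add: insert_at_Suc) (metis append.assoc le_add_diff_inverse less_imp_le take_add)
    moreover have "length (take (i - k) (drop k p)) = d" "d > 0" using k ki i by simp_all
    moreover have "\<forall>y \<in> set (take (i - k) (drop k p)). a > y"
      using less by (meson in_set_takeD in_set_dropD)
    moreover have "dir = Leftward" using k(4) ki by simp
    ultimately show ?thesis by (simp only: jump.simps) blast
  qed
qed

text \<open>A smaller value cannot jump over \<open>m\<close>, so \<open>m\<close> at the border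
  stays outside the affected substring.\<close>

lemma jump_extend_iff:
  assumes less: "\<forall>x \<in> set p. x < m" and a: "a \<noteq> m"
  shows "jump dir (extend b m p) a d q' \<longleftrightarrow> (\<exists>q. q' = extend b m q \<and> jump dir p a d q)"
proof
  assume jmp: "jump dir (extend b m p) a d q'"
  then have "a \<in> set p" using set_jump[OF jmp] a by (auto simp: extend_def split: if_splits)
  then have am: "a < m" using less by blast
  show "\<exists>q. q' = extend b m q \<and> jump dir p a d q"
  proof (cases dir)
    case Rightward
    then obtain xs ys zs where e: "extend b m p = xs @ [a] @ ys @ zs" and q': "q' = xs @ ys @ [a] @ zs"
      and d: "length ys = d" "d > 0" "\<forall>y \<in> set ys. a > y"
      using jmp by auto
    show ?thesis
    proof (cases b)
      case True
      \<comment> \<open>Otherwise \<open>m\<close> would be the last of the entries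
        \<open>ys\<close> jumped over, all of which are smaller than \<open>a\<close>.\<close>
      have "zs \<noteq> []"
      proof
        assume "zs = []"
        then have "last ys = m" using e True d by (auto simp: extend_def dest: arg_cong[where f = last] split: if_splits)
        moreover have "last ys \<in> set ys" using d by (intro last_in_set) auto
        ultimately show False using d(3) am by auto
      qed
      then obtain zs' where zs: "zs = zs' @ [m]"
        using e True by (metis append.assoc append_butlast_last_id extend_def last_appendR snoc_eq_iff_butlast)
      then have "p = xs @ [a] @ ys @ zs'" using e True by (simp add: extend_def)
      then show ?thesis using q' zs True Rightward d
        by (intro exI[of _ "xs @ ys @ [a] @ zs'"]) (auto simp: extend_def)
    next
      case False
      then obtain xs' where xs: "xs = m # xs'" using e a by (cases xs) (auto simp: extend_def)
      then have "p = xs' @ [a] @ ys @ zs" using e False by (simp add: extend_def)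
      then show ?thesis using q' xs False Rightward d
        by (intro exI[of _ "xs' @ ys @ [a] @ zs"]) (auto simp: extend_def)
    qed
  next
    case Leftward
    then obtain xs ys zs where e: "extend b m p = xs @ ys @ [a] @ zs" and q': "q' = xs @ [a] @ ys @ zs"
      and d: "length ys = d" "d > 0" "\<forall>y \<in> set ys. a > y"
      using jmp by auto
    show ?thesis
    proof (cases b)
      case True
      have "zs \<noteq> []" using e True a by (auto simp: extend_def)
      then obtain zs' where zs: "zs = zs' @ [m]"
        using e True by (metis append.assoc append_butlast_last_id extend_def last_appendR snoc_eq_iff_butlast)
      then have "p = xs @ ys @ [a] @ zs'" using e True by (simp add: extend_def)
      then show ?thesis using q' zs True Leftward d
        by (intro exI[of _ "xs @ [a] @ ys @ zs'"]) (auto simp: extend_def)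
    next
      case False
      have "xs \<noteq> []"
      proof
        assume "xs = []"
        then have "hd ys = m" using e False d by (cases ys) (auto simp: extend_def)
        moreover have "hd ys \<in> set ys" using d by (intro hd_in_set) auto
        ultimately show False using d(3) am by auto
      qed
      then obtain xs' where xs: "xs = m # xs'" using e False by (cases xs) (auto simp: extend_def)
      then have "p = xs' @ ys @ [a] @ zs" using e False by (simp add: extend_def)
      then show ?thesis using q' xs False Leftward d
        by (intro exI[of _ "xs' @ [a] @ ys @ zs"]) (auto simp: extend_def)
    qed
  qed
next
  have "\<exists>xs' ys' zs'. extend b m (xs @ us @ zs) = xs' @ us @ zs' \<and>
    extend b m (xs @ vs @ zs) = xs' @ vs @ zs'" for xs us vs zs :: "nat list"
    by (cases b) (auto simp: extend_def intro: exI[of _ "m # xs"] exI[of _ "zs @ [m]"])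
  note ext = this
  assume "\<exists>q. q' = extend b m q \<and> jump dir p a d q"
  then obtain q where q: "q' = extend b m q" "jump dir p a d q" by blast
  show "jump dir (extend b m p) a d q'"
  proof (cases dir)
    case Rightward
    then obtain xs ys zs where *: "p = xs @ ([a] @ ys) @ zs" "q = xs @ (ys @ [a]) @ zs"
      "length ys = d" "d > 0" "\<forall>y \<in> set ys. a > y" using q(2) by auto
    then obtain xs' zs' where "extend b m p = xs' @ ([a] @ ys) @ zs'" "q' = xs' @ (ys @ [a]) @ zs'"
      using ext[of xs "[a] @ ys" zs "ys @ [a]"] unfolding q(1) *(1,2) by metis
    then show ?thesis using *(3-) unfolding Rightward jump.simps by simp blast
  next
    case Leftward
    then obtain xs ys zs where *: "p = xs @ (ys @ [a]) @ zs" "q = xs @ ([a] @ ys) @ zs"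
      "length ys = d" "d > 0" "\<forall>y \<in> set ys. a > y" using q(2) by auto
    then obtain xs' zs' where "extend b m p = xs' @ (ys @ [a]) @ zs'" "q' = xs' @ ([a] @ ys) @ zs'"
      using ext[of xs "ys @ [a]" zs "[a] @ ys"] unfolding q(1) *(1,2) by metis
    then show ?thesis using *(3-) unfolding Leftward jump.simps by simp blast
  qed
qed


subsection \<open>Lifting runs of Algorithm J\<close>

text \<open>The flag says whether the next list is reversed. The flag is \<open>True\<close> at the
  start of the whole run, since the identity has its largest value at the last position.\<close>

fun zigzag :: "('a \<Rightarrow> 'b list) \<Rightarrow> bool \<Rightarrow> 'a list \<Rightarrow> 'b list" where
  "zigzag f b [] = []"
| "zigzag f b (x # xs) = (if b then rev (f x) else f x) @ zigzag f (\<not> b) xs"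

lemma set_zigzag: "set (zigzag f b xs) = (\<Union>x \<in> set xs. set (f x))"
  by (induction xs arbitrary: b) auto

lemma map_zigzag:
  "(\<And>x. x \<in> set xs \<Longrightarrow> map h (f x) = g (k x)) \<Longrightarrow> map h (zigzag f b xs) = zigzag g b (map k xs)"
  by (induction xs arbitrary: b) (auto simp flip: rev_map)

lemma distinct_zigzag:
  assumes "distinct xs" "\<And>x. x \<in> set xs \<Longrightarrow> distinct (f x)"
    "\<And>x y. x \<in> set xs \<Longrightarrow> y \<in> set xs \<Longrightarrow> x \<noteq> y \<Longrightarrow> set (f x) \<inter> set (f y) = {}"
  shows "distinct (zigzag f b xs)"
  using assms
proof (induction xs arbitrary: b)
  case (Cons x xs)
  have "distinct (zigzag f (\<not> b) xs)" using Cons.prems by (intro Cons.IH) auto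
  moreover have "set (f x) \<inter> (\<Union>y \<in> set xs. set (f y)) = {}"
    using Cons.prems(1,3) by fastforce
  ultimately show ?case using Cons.prems by (auto simp: set_zigzag)
qed simp

text \<open>A reversed list ends at its head and the next one starts at its head, or both meet at
  their last elements; so only these two kinds of crossings matter.\<close>

lemma successively_zigzag:
  assumes sym: "\<And>x y. P x y \<Longrightarrow> P y x"
    and f: "\<And>x. x \<in> set xs \<Longrightarrow> f x \<noteq> [] \<and> successively P (f x)"
    and Q: "successively Q xs"
    and QP: "\<And>x y. x \<in> set xs \<Longrightarrow> y \<in> set xs \<Longrightarrow> Q x y \<Longrightarrow> P (hd (f x)) (hd (f y)) \<and> P (last (f x)) (last (f y))"
  shows "successively P (zigzag f b xs)"
  using f Q QP
proof (induction xs arbitrary: b)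
  case (Cons x xs)
  have sx: "successively P (if b then rev (f x) else f x)"
    using Cons.prems(1)[of x] sym by (auto simp: successively_rev elim: successively_mono)
  show ?case
  proof (cases xs)
    case Nil
    then show ?thesis using sx by simp
  next
    case (Cons y ys)
    have IH: "successively P (zigzag f (\<not> b) xs)"
      using Cons.prems by (intro Cons.IH) (auto simp: Cons)
    have fx: "f x \<noteq> []" "f y \<noteq> []" using Cons.prems(1) Cons by auto
    have "P (hd (f x)) (hd (f y))" "P (last (f x)) (last (f y))"
      using Cons.prems(2,3) Cons by auto
    moreover have "hd (zigzag f (\<not> b) xs) = (if b then hd (f y) else last (f y))"
      using fx Cons by (auto simp: hd_append hd_rev)
    ultimately show ?thesis
      using sx IH fx by (auto simp: successively_append_iff last_rev)
  qed
qed simp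

locale permutation_extension =
  fixes n :: nat and L L' :: "nat list set"
  assumes L: "L \<subseteq> permutations_of_set {1..n}"
    and L': "\<And>q. q \<in> L' \<Longrightarrow> \<exists>p \<in> L. \<exists>i \<le> n. q = insert_at (Suc i) (Suc n) p"
begin

abbreviation ins :: "nat \<Rightarrow> nat list \<Rightarrow> nat list" where
  "ins i p \<equiv> insert_at (Suc i) (Suc n) p"

abbreviation ext :: "bool \<Rightarrow> nat list \<Rightarrow> nat list" where
  "ext b p \<equiv> extend b (Suc n) p"

lemma L_less:
  assumes "p \<in> L"
  shows "\<forall>x \<in> set p. x < Suc n" "Suc n \<notin> set p" "length p = n"
proof -
  have p: "set p = {1..n}" "distinct p" using assms L by (auto simp: permutations_of_set_def)
  then show "\<forall>x \<in> set p. x < Suc n" "Suc n \<notin> set p" by auto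
  show "length p = n" using p distinct_card[of p] by simp
qed

lemma ext_ins: "p \<in> L \<Longrightarrow> ext b p = ins (if b then n else 0) p"
  using L_less(3) by (auto simp: extend_insert_at)

lemma ins_cancel: "p \<in> L \<Longrightarrow> q \<in> L \<Longrightarrow> ins i p = ins j q \<Longrightarrow> p = q"
  using L_less(2) remove1_insert_at by metis

lemma ext_mem_L'D: "Suc n \<notin> set q \<Longrightarrow> ext b q \<in> L' \<Longrightarrow> q \<in> L"
  using L' L_less(2) remove1_insert_at remove1_extend by metis

text \<open>All permutations of \<open>L'\<close> lying over \<open>U\<close>. Whenever the lifted
  run has just completed a rail, its visited set is the expansion of what the shorter run has
  visited.\<close>

definition expansion :: "nat list set \<Rightarrow> nat list set" where
  "expansion U = {q \<in> L'. \<exists>p \<in> U. \<exists>i. q = ins i p}"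

lemma ext_mem_expansion:
  assumes "U \<subseteq> L" "Suc n \<notin> set q" "ext b q \<in> expansion U"
  shows "q \<in> U"
proof -
  obtain p i where p: "p \<in> U" "ext b q = ins i p" using assms(3) by (auto simp: expansion_def)
  then have "Suc n \<notin> set p" using assms(1) L_less(2) by blast
  then have "q = p" using p(2) assms(2) remove1_insert_at remove1_extend by metis
  with p show ?thesis by simp
qed

text \<open>The rail of the current permutation is exhausted, so jumps of the largest value reach
  only visited permutations or leave \<open>L'\<close>. For smaller values, jumps, membership and
  being visited all correspond under \<open>ext b\<close>, hence so do minimality, the largest
  possible value and the absence of ambiguity.\<close>

lemma step_extend:
  assumes ends: "\<And>p. p \<in> L \<Longrightarrow> ext b p \<in> L'"
    and us: "us \<noteq> []" "set us \<subseteq> L"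
    and us': "last us' = ext b (last us)" "set us' = expansion (set us)"
    and step: "algorithm_J_step L us q"
  shows "algorithm_J_step L' us' (ext b q)"
proof -
  define p where "p = last us"
  have p: "p \<in> L" "p \<in> set us" using us by (auto simp: p_def)
  note p_less = L_less[OF p(1)]
  have jump_iff: "jump dir (ext b p) a d q' \<longleftrightarrow> (\<exists>q. q' = ext b q \<and> jump dir p a d q)"
    if "a \<noteq> Suc n" for dir a d q'
    using jump_extend_iff[OF p_less(1) that] .
  have new: "a \<noteq> Suc n" "Suc n \<notin> set q" if "jump dir p a d q" for dir a d q
    using set_jump[OF that] p_less(2) by auto
  have ext_L': "ext b q \<in> L' \<longleftrightarrow> q \<in> L" if "Suc n \<notin> set q" for q
    using that ends ext_mem_L'D by blast
  have ext_us': "ext b q \<in> set us' \<longleftrightarrow> q \<in> set us" if "Suc n \<notin> set q" for q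
  proof
    show "ext b q \<in> set us' \<Longrightarrow> q \<in> set us" using ext_mem_expansion us(2) us'(2) that by blast
    assume q: "q \<in> set us"
    then have "q \<in> L" using us by blast
    then show "ext b q \<in> set us'" using q ends ext_ins us'(2) by (auto simp: expansion_def)
  qed
  have a_new: "a \<noteq> Suc n" if adm: "admissible L' us' dir a q'" for dir a q'
  proof
    assume a: "a = Suc n"
    obtain d where "jump dir (ext b p) (Suc n) d q'"
      using adm us'(1) a by (auto simp: admissible_def minimal_jump_def p_def)
    then obtain k where "q' = ins k p"
      using jump_new_iff[OF p_less(1), of "if b then n else 0"] p_less(3) ext_ins[OF p(1)] by auto
    then have "q' \<in> set us'" using adm p us'(2) by (auto simp: expansion_def admissible_def)
    then show False using adm by (simp add: admissible_def)
  qed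
  have min_iff: "minimal_jump L' dir (ext b p) a d (ext b q) \<longleftrightarrow> minimal_jump L dir p a d q"
    if "jump dir p a d q" for dir a d q
  proof -
    have "ext b q' \<notin> L' \<longleftrightarrow> q' \<notin> L" if "jump dir p a d' q'" for d' q'
      using ext_L' new[OF that] by blast
    then show ?thesis
      unfolding minimal_jump_def jump_iff[OF new(1)[OF that]] using that by blast
  qed
  have adm_iff: "admissible L' us' dir a q' \<longleftrightarrow> (\<exists>q. q' = ext b q \<and> admissible L us dir a q)" for dir a q'
  proof
    assume adm: "admissible L' us' dir a q'"
    then obtain d where d: "minimal_jump L' dir (ext b p) a d q'"
      using us'(1) by (auto simp: admissible_def p_def)
    then obtain q where q: "q' = ext b q" "jump dir p a d q"
      using a_new[OF adm] jump_iff by (auto simp: minimal_jump_def)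
    then have "admissible L us dir a q"
      using adm d min_iff new[OF q(2)] ext_L' ext_us' unfolding admissible_def p_def by blast
    then show "\<exists>q. q' = ext b q \<and> admissible L us dir a q" using q by blast
  next
    assume "\<exists>q. q' = ext b q \<and> admissible L us dir a q"
    then obtain q d where q: "q' = ext b q" "minimal_jump L dir p a d q" "q \<in> L" "q \<notin> set us"
      by (auto simp: admissible_def p_def)
    then have "jump dir p a d q" by (simp add: minimal_jump_def)
    then show "admissible L' us' dir a q'"
      using q min_iff new ext_L' ext_us' us'(1) unfolding admissible_def p_def[symmetric] by metis
  qed
  from step show ?thesis unfolding algorithm_J_step_def adm_iff by blast
qed

text \<open>The positions in \<open>L'\<close> are traversed monotonically. No such position lies
  between \<open>i\<close> and \<open>j\<close>, which makes the jump minimal, and those on the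
  other side of \<open>i\<close> are already visited, which fixes the direction.\<close>

lemma step_new:
  assumes p: "p \<in> L"
    and js: "sorted_wrt (<) js \<or> sorted_wrt (>) js" "js = hs @ i # j # ks"
    and js_set: "set js = {i. i \<le> n \<and> ins i p \<in> L'}"
    and us: "\<And>k. ins k p \<notin> set us"
  shows "algorithm_J_step L' (us @ map (\<lambda>i. ins i p) (hs @ [i])) (ins j p)"
proof -
  let ?us = "us @ map (\<lambda>i. ins i p) (hs @ [i])"
  let ?dir = "\<lambda>k. if i < k then Rightward else Leftward"
  note p_less = L_less[OF p]
  have mem: "k \<in> set js \<longleftrightarrow> k \<le> n \<and> ins k p \<in> L'" for k using js_set by simp
  have i: "i \<le> n" and j: "j \<le> n" "ins j p \<in> L'" using mem js(2) by auto
  have jump_iff: "jump dir (ins i p) (Suc n) d q \<longleftrightarrow>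
    (\<exists>k \<le> n. q = ins k p \<and> k \<noteq> i \<and> dir = ?dir k \<and> d = (k - i) + (i - k))" for dir d q
    using jump_new_iff[OF p_less(1), of i] i p_less(3) by simp
  have inj: "ins k p = ins l p \<longleftrightarrow> k = l" if "k \<le> n" "l \<le> n" for k l
    using insert_at_inj[OF p_less(2)] p_less(3) that by simp
  have hs_le: "k \<le> n" if "k \<in> set hs" for k using mem js(2) that by auto
  have ij: "i \<noteq> j" "j \<notin> set hs" using js by (auto simp: sorted_wrt_append)
  have "ins j p \<notin> set ?us" using us ij inj hs_le i j by auto
  moreover have "minimal_jump L' (?dir j) (ins i p) (Suc n) ((j - i) + (i - j)) (ins j p)"
    unfolding minimal_jump_def jump_iff
  proof (intro conjI allI impI)
    show "\<exists>k \<le> n. ins j p = ins k p \<and> k \<noteq> i \<and> ?dir j = ?dir k \<and> j - i + (i - j) = k - i + (i - k)"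
      using ij j by auto
    fix d' q' assume "d' < j - i + (i - j) \<and> (\<exists>k \<le> n. q' = ins k p \<and> k \<noteq> i \<and> ?dir j = ?dir k \<and> d' = k - i + (i - k))"
    then obtain k where k: "k \<le> n" "q' = ins k p" "i < k \<and> k < j \<or> j < k \<and> k < i"
      by (auto split: if_splits)
    show "q' \<notin> L'"
    proof
      assume "q' \<in> L'"
      then have "k \<in> set js" using k mem by blast
      then show False using js k(3) by (auto simp: sorted_wrt_append)
    qed
  qed
  ultimately have "admissible L' ?us (?dir j) (Suc n) (ins j p)"
    using j by (auto simp: admissible_def)
  moreover have "a \<le> Suc n" if adm: "admissible L' ?us dir a q" for dir a q
  proof -
    obtain d where "jump dir (ins i p) a d q"
      using adm by (auto simp: admissible_def minimal_jump_def)
    then have "a \<in> set (ins i p)" using set_jump by blast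
    then show ?thesis using p_less(1) by auto
  qed
  moreover have "dir = ?dir j" if adm: "admissible L' ?us dir (Suc n) q" for dir q
  proof (rule ccontr)
    assume dir: "dir \<noteq> ?dir j"
    obtain d where "jump dir (ins i p) (Suc n) d q"
      using adm by (auto simp: admissible_def minimal_jump_def)
    then obtain k where k: "k \<le> n" "q = ins k p" "k \<noteq> i" "dir = ?dir k"
      by (auto simp: jump_iff)
    then have "k \<in> set js" using adm mem by (auto simp: admissible_def)
    \<comment> \<open>A jump in the opposite direction lands behind the current position, that is,
      among the visited positions \<open>hs\<close>.\<close>
    moreover have "k < i \<and> i < j \<or> i < k \<and> j < i" using k(3,4) dir ij(1) by (auto split: if_splits)
    ultimately have "k \<in> set hs" using js by (auto simp: sorted_wrt_append)
    then have "q \<in> set ?us" using k by auto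
    then show False using adm by (simp add: admissible_def)
  qed
  ultimately show ?thesis unfolding algorithm_J_step_def by blast
qed

lemma J_run_new:
  assumes p: "p \<in> L"
    and js: "sorted_wrt (<) (hs @ i # ks) \<or> sorted_wrt (>) (hs @ i # ks)"
    and js_set: "set (hs @ i # ks) = {i. i \<le> n \<and> ins i p \<in> L'}"
    and us: "\<And>k. ins k p \<notin> set us"
  shows "J_run L' (us @ map (\<lambda>i. ins i p) (hs @ [i])) (map (\<lambda>i. ins i p) ks)"
  using js js_set
proof (induction ks arbitrary: hs i)
  case (Cons j ks)
  have "algorithm_J_step L' (us @ map (\<lambda>i. ins i p) (hs @ [i])) (ins j p)"
    using Cons.prems us by (intro step_new[OF p, where js = "hs @ i # j # ks"]) auto
  moreover have "J_run L' (us @ map (\<lambda>i. ins i p) ((hs @ [i]) @ [j])) (map (\<lambda>i. ins i p) ks)"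
    using Cons.prems by (intro Cons.IH) simp_all
  ultimately show ?case by simp
qed simp

end

section \<open>Zigzags through the positions of the largest value\<close>

lemma ends_sorted_list_of_set:
  assumes "0 \<in> T" "n \<in> T" "T \<subseteq> {..n::nat}"
  shows "sorted_list_of_set T \<noteq> []" "hd (sorted_list_of_set T) = 0" "last (sorted_list_of_set T) = n"
proof -
  let ?s = "sorted_list_of_set T"
  have set: "set ?s = T" using assms(3) finite_subset[of T "{..n}"] by simp
  show ne: "?s \<noteq> []" using assms(1) set by (metis empty_iff list.set(1))
  have "hd xs \<le> x" "x \<le> last xs" if "sorted xs" "x \<in> set xs" for xs :: "nat list" and x
  proof -
    show "hd xs \<le> x" using that by (cases xs) auto
    show "x \<le> last xs" using that by (cases xs rule: rev_cases) (auto simp: sorted_append)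
  qed
  from this(1)[of ?s 0] this(2)[of ?s n] have "hd ?s \<le> 0" "n \<le> last ?s"
    using assms(1,2) set sorted_sorted_list_of_set[of T] by blast+
  moreover have "last ?s \<le> n"
    using last_in_set[OF ne] assms(3) unfolding set by blast
  ultimately show "hd ?s = 0" "last ?s = n" by simp_all
qed

definition positions :: "nat \<Rightarrow> nat list set \<Rightarrow> nat list \<Rightarrow> nat list" where
  "positions n L' p = sorted_list_of_set {i. i \<le> n \<and> insert_at (Suc i) (Suc n) p \<in> L'}"

definition block :: "nat \<Rightarrow> nat list set \<Rightarrow> nat list \<Rightarrow> nat list list" where
  "block n L' p = map (\<lambda>i. insert_at (Suc i) (Suc n) p) (positions n L' p)"

locale zigzag_extension = permutation_extension +
  assumes ends: "\<And>p b. p \<in> L \<Longrightarrow> extend b (Suc n) p \<in> L'"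
begin

lemma directed_positions:
  assumes p: "p \<in> L" and js: "js = (if b then rev (positions n L' p) else positions n L' p)"
  shows "set js = {i. i \<le> n \<and> ins i p \<in> L'}"
    "sorted_wrt (<) js \<or> sorted_wrt (>) js" "js \<noteq> []"
    "ins (hd js) p = ext b p" "ins (last js) p = ext (\<not> b) p"
    "(if b then rev (block n L' p) else block n L' p) = map (\<lambda>i. ins i p) js"
proof -
  let ?T = "{i. i \<le> n \<and> ins i p \<in> L'}"
  let ?s = "sorted_list_of_set ?T"
  have fin: "finite ?T" by simp
  have T: "0 \<in> ?T" "n \<in> ?T" "?T \<subseteq> {..n}" using ends[OF p, of False] ends[OF p, of True] ext_ins[OF p] by auto
  have sorted: "sorted_wrt (<) ?s" and set: "set ?s = ?T"
    using fin by (auto simp: strict_sorted_list_of_set)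
  have ne: "?s \<noteq> []" and ends_eq: "hd ?s = 0" "last ?s = n"
    using ends_sorted_list_of_set[OF T] by auto
  show "set js = ?T" using set by (auto simp: js positions_def)
  show "sorted_wrt (<) js \<or> sorted_wrt (>) js"
    using sorted by (auto simp: js positions_def sorted_wrt_rev)
  show "js \<noteq> []" using ne by (auto simp: js positions_def)
  show "ins (hd js) p = ext b p" "ins (last js) p = ext (\<not> b) p"
    using ends_eq ne by (auto simp: js positions_def ext_ins[OF p] hd_rev last_rev)
  show "(if b then rev (block n L' p) else block n L' p) = map (\<lambda>i. ins i p) js"
    by (auto simp: js block_def rev_map)
qed

text \<open>The invariant: the last visit has the largest value at border \<open>b\<close>, and
  every rail met so far is exhausted. A step of the shorter run enters the next rail at border
  \<open>b\<close>; sweeping that rail ends at the opposite border and restores the invariant with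
  \<open>b\<close> negated.\<close>

lemma J_run_zigzag:
  assumes "J_run L us vs" "us \<noteq> []" "set us \<subseteq> L" "set vs \<subseteq> L"
    and "us' \<noteq> []" "last us' = ext b (last us)" "set us' = expansion (set us)"
  shows "J_run L' us' (zigzag (block n L') b vs)"
  using assms
proof (induction vs arbitrary: us us' b)
  case (Cons v vs)
  have v: "v \<in> L" and step: "algorithm_J_step L us v" and run: "J_run L (us @ [v]) vs"
    using Cons.prems by auto
  have v_new: "v \<notin> set us" using step by (auto simp: algorithm_J_step_def admissible_def)
  define js where "js = (if b then rev (positions n L' v) else positions n L' v)"
  note js = directed_positions[OF v js_def]
  obtain i ks where jsi: "js = i # ks" using js(3) by (cases js) auto
  have "algorithm_J_step L' us' (ext b v)"
    using Cons.prems step ends by (intro step_extend) auto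
  then have "algorithm_J_step L' us' (ins i v)" using js(4) jsi by simp
  moreover have "J_run L' (us' @ map (\<lambda>i. ins i v) ([] @ [i])) (map (\<lambda>i. ins i v) ks)"
  proof (rule J_run_new[OF v])
    show "ins k v \<notin> set us'" for k
    proof
      assume "ins k v \<in> set us'"
      then obtain p i where "p \<in> set us" "ins k v = ins i p"
        using Cons.prems(7) by (auto simp: expansion_def)
      moreover from this have "v = p" using Cons.prems(3) v ins_cancel by blast
      ultimately show False using v_new by simp
    qed
  qed (use js jsi in simp_all)
  ultimately have "J_run L' us' (map (\<lambda>i. ins i v) js)" using jsi by simp
  moreover have "J_run L' (us' @ map (\<lambda>i. ins i v) js) (zigzag (block n L') (\<not> b) vs)"
  proof (rule Cons.IH[OF run])
    show "set (us' @ map (\<lambda>i. ins i v) js) = expansion (set (us @ [v]))"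
      using Cons.prems(7) js(1) v L' ins_cancel
      unfolding expansion_def by (simp add: set_eq_iff) (metis (no_types, lifting) imageE imageI mem_Collect_eq)
    show "last (us' @ map (\<lambda>i. ins i v) js) = ext (\<not> b) (last (us @ [v]))"
      using js(3,5) by (simp add: last_map)
  qed (use Cons.prems v in auto)
  ultimately show ?case using js(6) by (simp add: J_run_append)
qed simp

text \<open>The first permutation is given rather than reached by a step, so the sweep of its rail
  is treated separately and then establishes the invariant of \<open>J_run_zigzag\<close>.\<close>

lemma J_run_zigzag_init:
  assumes "J_run L [p] ps" "set (p # ps) \<subseteq> L"
  shows "\<exists>qs. zigzag (block n L') True (p # ps) = ext True p # qs \<and> J_run L' [ext True p] qs"
proof -
  have p: "p \<in> L" using assms by simp
  define js where "js = (if True then rev (positions n L' p) else positions n L' p)"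
  note js = directed_positions[OF p js_def]
  obtain i ks where jsi: "js = i # ks" using js(3) by (cases js) auto
  have "J_run L' ([] @ map (\<lambda>i. ins i p) ([] @ [i])) (map (\<lambda>i. ins i p) ks)"
    by (rule J_run_new[OF p]) (use js jsi in simp_all)
  moreover have "J_run L' (map (\<lambda>i. ins i p) js) (zigzag (block n L') False ps)"
  proof (rule J_run_zigzag[OF assms(1)])
    show "set (map (\<lambda>i. ins i p) js) = expansion (set [p])"
      using js(1) p L' ins_cancel
      unfolding expansion_def by (simp add: set_eq_iff) (metis (no_types, lifting) imageE imageI mem_Collect_eq)
    show "last (map (\<lambda>i. ins i p) js) = ext False (last [p])"
      using js(3,5) by (simp add: last_map)
  qed (use assms js in auto)
  ultimately show ?thesis
    using js(4,6) jsi J_run_append[of L' "[ins i p]" "map (\<lambda>i. ins i p) ks"] by auto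
qed

end

text \<open>The counterpart for the collapsed case: each rail contributes one permutation, is
  exhausted as soon as it is entered, and \<open>step_extend\<close> at the right border accounts
  for every step.\<close>

lemma J_run_append_new:
  assumes L: "L \<subseteq> permutations_of_set {1..n}"
    and "J_run L us vs" "us \<noteq> []" "set us \<subseteq> L" "set vs \<subseteq> L"
  shows "J_run ((\<lambda>p. p @ [Suc n]) ` L) (map (\<lambda>p. p @ [Suc n]) us) (map (\<lambda>p. p @ [Suc n]) vs)"
  using assms(2-)
proof (induction vs arbitrary: us)
  case (Cons v vs)
  let ?L' = "(\<lambda>p. p @ [Suc n]) ` L"
  have len: "length p = n" if "p \<in> L" for p
    using length_finite_permutations_of_set[of p "{1..n}"] that L by auto
  interpret permutation_extension n L ?L'
  proof
    fix q assume "q \<in> ?L'"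
    then obtain p where p: "p \<in> L" "q = p @ [Suc n]" by blast
    then have "q = insert_at (Suc n) (Suc n) p" using len by (simp add: insert_at_def)
    with p(1) show "\<exists>p \<in> L. \<exists>i \<le> n. q = insert_at (Suc i) (Suc n) p" by blast
  qed (rule L)
  have "algorithm_J_step ?L' (map (\<lambda>p. p @ [Suc n]) us) (ext True v)"
  proof (rule step_extend)
    show "set (map (\<lambda>p. p @ [Suc n]) us) = expansion (set us)"
    proof -
      have snoc: "p @ [Suc n] = ins n p" if "p \<in> L" for p using that len by (simp add: insert_at_def)
      show ?thesis
      proof (intro equalityI subsetI)
        fix q assume "q \<in> set (map (\<lambda>p. p @ [Suc n]) us)"
        then obtain p where p: "p \<in> set us" "q = p @ [Suc n]" by auto
        then have "p \<in> L" using Cons.prems(3) by blast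
        then show "q \<in> expansion (set us)" using p snoc unfolding expansion_def by blast
      next
        fix q assume "q \<in> expansion (set us)"
        then obtain p i p' where p: "p \<in> set us" "q = ins i p" "p' \<in> L" "q = p' @ [Suc n]"
          by (auto simp: expansion_def)
        then have "p = p'" using ins_cancel[of p p' i n] snoc Cons.prems(3) by auto
        then show "q \<in> set (map (\<lambda>p. p @ [Suc n]) us)" using p(1,4) by simp
      qed
    qed
  qed (use Cons.prems in \<open>auto simp: extend_def last_map\<close>)
  moreover have "J_run ?L' (map (\<lambda>p. p @ [Suc n]) (us @ [v])) (map (\<lambda>p. p @ [Suc n]) vs)"
    using Cons.prems by (intro Cons.IH) auto
  ultimately show ?case by (simp add: extend_def)
qed simp


section \<open>Encoding reorientations by permutations\<close>

lemma position_eq: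
  assumes "distinct (xs @ v # ys)"
  shows "position (xs @ v # ys) v = Suc (length xs)"
  unfolding position_def
proof (rule the_equality)
  fix i assume i: "1 \<le> i \<and> i \<le> length (xs @ v # ys) \<and> (xs @ v # ys) ! (i - 1) = v"
  then have "(xs @ v # ys) ! (i - 1) = (xs @ v # ys) ! length xs" by simp
  then have "i - 1 = length xs" using assms i by (subst (asm) nth_eq_iff_index_eq) auto
  then show "i = Suc (length xs)" using i by linarith
qed simp

declare perm_of.simps(2) [simp del]

context simplicial_extension
begin

text \<open>
  The new vertex goes directly before the first of its out-neighbors, hence behind all of its
  in-neighbors, as the neighbors form a clique.
\<close>

lemma perm_of_extension:
  assumes F: "F \<in> carrier L"
    and p: "perm_of n (induced n F) \<in> permutations_of_set {1..n}"
    and sorted: "sorted_wrt (\<lambda>u v. (v, u) \<notin> induced n F) (perm_of n (induced n F))"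
  shows "\<exists>xs ys. perm_of n (induced n F) = xs @ ys \<and> perm_of (Suc n) F = xs @ Suc n # ys \<and>
    (\<forall>x. (x, Suc n) \<in> F \<longrightarrow> x \<in> set xs) \<and> (\<forall>x. (Suc n, x) \<in> F \<longrightarrow> x \<in> set ys) \<and>
    (is_sink F (Suc n) \<longrightarrow> ys = []) \<and> (is_source F (Suc n) \<and> \<not> is_sink F (Suc n) \<longrightarrow> xs = [])"
proof -
  define q where "q = perm_of n (induced n F)"
  have q: "set q = {1..n}" "distinct q" using p by (auto simp: permutations_of_set_def q_def)
  then have len: "length q = n" using distinct_card[of q] by simp
  have nbr: "x \<in> set q" if "(x, Suc n) \<in> F \<or> (Suc n, x) \<in> F" for x
    using nbr_range[OF F] that q(1) by auto
  consider "is_sink F (Suc n)" | "\<not> is_sink F (Suc n)" "is_source F (Suc n)"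
    | "\<not> is_sink F (Suc n)" "\<not> is_source F (Suc n)" by blast
  then show ?thesis
  proof cases
    case 1
    then have "perm_of (Suc n) F = q @ [Suc n]" using len by (simp add: perm_of.simps(2) q_def insert_at_def)
    moreover have "(Suc n, x) \<notin> F" for x using 1 by (auto simp: is_sink_def)
    ultimately show ?thesis using nbr 1 by (intro exI[of _ q] exI[of _ "[]"]) (simp add: q_def)
  next
    case 2
    then have "perm_of (Suc n) F = Suc n # q" by (simp add: perm_of.simps(2) q_def insert_at_def)
    moreover have "(x, Suc n) \<notin> F" for x using 2 by (auto simp: is_source_def)
    ultimately show ?thesis using nbr 2 by (intro exI[of _ "[]"] exI[of _ q]) (simp add: q_def)
  next
    case 3
    then have "\<exists>v \<in> set q. (Suc n, v) \<in> F" using nbr by (auto simp: is_sink_def)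
    \<comment> \<open>The candidate for the out-neighbor in the transitive reduction is the
      out-neighbor that comes first in the shorter word.\<close>
    then obtain xs v ys where split: "q = xs @ v # ys" "(Suc n, v) \<in> F"
      and first: "\<forall>x \<in> set xs. (Suc n, x) \<notin> F"
      using split_list_first_prop[of q "\<lambda>v. (Suc n, v) \<in> F"] by blast
    have ac: "acyclic F" and eq: "F \<union> F\<inverse> = A \<union> A\<inverse>" using F by (auto simp: carrier_AR[OF asym_A])
    have sorted_q: "(w, v) \<notin> F" if "w \<in> set ys" for w
    proof -
      have "(w, v) \<notin> induced n F"
        using sorted that split(1) by (auto simp: q_def[symmetric] sorted_wrt_append)
      moreover have "w \<in> {1..n}" "v \<in> {1..n}" using that split(1) q(1) by auto
      ultimately show ?thesis by (simp add: mem_induced_iff)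
    qed
    have v_first: "w \<in> set ys \<and> (v, w) \<in> F" if "(Suc n, w) \<in> F" "w \<noteq> v" for w
    proof -
      have w: "w \<in> set ys" using that nbr[of w] first split(1) by auto
      have "(v, w) \<in> A \<union> A\<inverse>" using nbrs_adjacent[of v w] that split(2) eq by blast
      then have "(v, w) \<in> F" using sorted_q[OF w] eq by blast
      with w show ?thesis ..
    qed
    \<comment> \<open>Any other out-neighbor \<open>w\<close> is bypassed by the path through
      \<open>v\<close>. A path to \<open>v\<close> avoiding the direct arc would leave through some
      such \<open>w\<close> and close a cycle with the arc from \<open>v\<close> to
      \<open>w\<close>.\<close>
    have red: "(Suc n, w) \<in> transitive_reduction F \<longleftrightarrow> w = v" for w
    proof
      assume w: "(Suc n, w) \<in> transitive_reduction F"
      show "w = v"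
      proof (rule ccontr)
        assume "w \<noteq> v"
        then have "(v, w) \<in> F" using w v_first by (auto simp: transitive_reduction_def)
        moreover have "v \<noteq> Suc n" using split(1) q(1) by force
        ultimately have "(Suc n, v) \<in> F - {(Suc n, w)}" "(v, w) \<in> F - {(Suc n, w)}"
          using split(2) \<open>w \<noteq> v\<close> by auto
        then have "(Suc n, w) \<in> (F - {(Suc n, w)})\<^sup>+" by (meson trancl.simps)
        then show False using w by (simp add: transitive_reduction_def)
      qed
    next
      assume w: "w = v"
      have "(Suc n, v) \<notin> (F - {(Suc n, v)})\<^sup>+"
      proof
        assume "(Suc n, v) \<in> (F - {(Suc n, v)})\<^sup>+"
        then obtain x where x: "(Suc n, x) \<in> F - {(Suc n, v)}" "(x, v) \<in> (F - {(Suc n, v)})\<^sup>*"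
          by (meson tranclD)
        then have "(v, x) \<in> F" using v_first by blast
        moreover have "(x, v) \<in> F\<^sup>*" using x(2) rtrancl_mono[of "F - {(Suc n, v)}" F] by blast
        ultimately have "(v, v) \<in> F\<^sup>+" by (rule rtrancl_into_trancl2)
        then show False using ac by (simp add: acyclic_def)
      qed
      then show "(Suc n, w) \<in> transitive_reduction F" using w split(2) by (simp add: transitive_reduction_def)
    qed
    then have "(THE w. (Suc n, w) \<in> transitive_reduction F) = v" by simp
    moreover have "position q v = Suc (length xs)" using q(2) unfolding split(1) by (rule position_eq)
    ultimately have "perm_of (Suc n) F = insert_at (Suc (length xs)) (Suc n) q"
      using 3 by (simp add: perm_of.simps(2) q_def[symmetric])
    then have "perm_of (Suc n) F = xs @ Suc n # v # ys" by (simp add: insert_at_def split(1))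
    moreover have "x \<in> set (v # ys)" if "(Suc n, x) \<in> F" for x using v_first that by auto
    moreover have "x \<in> set xs" if x: "(x, Suc n) \<in> F" for x
    proof -
      have "(x, v) \<in> F" using F x split(2) by (rule transitive_at_vertex)
      moreover from this have "x \<noteq> v" using ac by (auto simp: acyclic_def)
      ultimately show ?thesis using nbr[of x] x split(1) sorted_q by auto
    qed
    ultimately show ?thesis using 3 split(1) by (intro exI[of _ xs] exI[of _ "v # ys"]) (simp add: q_def)
  qed
qed

end

text \<open>The encoding is a topological order. Sortedness has to accompany the induction because
  the placement of the next vertex depends on it.\<close>

lemma perm_of_linear_extension:
  "digraph_on n A \<Longrightarrow> peo_consistent n A \<Longrightarrow> F \<in> carrier (AR A) \<Longrightarrow>
    perm_of n F \<in> permutations_of_set {1..n} \<and> sorted_wrt (\<lambda>u v. (v, u) \<notin> F) (perm_of n F)"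
proof (induction n arbitrary: A F)
  case (Suc n)
  note step = peo_consistent_SucD[OF Suc.prems(1,2)]
  interpret simplicial_extension n A by (rule step)
  have IH: "perm_of n (induced n F) \<in> permutations_of_set {1..n}"
    "sorted_wrt (\<lambda>u v. (v, u) \<notin> induced n F) (perm_of n (induced n F))"
    using Suc.IH[OF step(2,3) induced_closed[OF Suc.prems(3)]] by blast+
  obtain xs ys where p: "perm_of n (induced n F) = xs @ ys" "perm_of (Suc n) F = xs @ Suc n # ys"
    and x: "\<And>x. (x, Suc n) \<in> F \<Longrightarrow> x \<in> set xs" and y: "\<And>x. (Suc n, x) \<in> F \<Longrightarrow> x \<in> set ys"
    using perm_of_extension[OF Suc.prems(3) IH] by blast
  have set: "set xs \<union> set ys = {1..n}" "distinct (xs @ ys)"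
    using IH(1) p(1) by (auto simp: permutations_of_set_def)
  have "sorted_wrt (\<lambda>u v. (v, u) \<notin> F) (xs @ ys)"
    using IH(2) unfolding p(1)
  proof (rule sorted_wrt_mono_rel[rotated])
    fix u v assume "u \<in> set (xs @ ys)" "v \<in> set (xs @ ys)" "(v, u) \<notin> induced n F"
    then show "(v, u) \<notin> F" using set(1) by (auto simp: mem_induced_iff)
  qed
  then have "sorted_wrt (\<lambda>u v. (v, u) \<notin> F) (perm_of (Suc n) F)"
    using x y set(2) unfolding p(2) by (auto simp: sorted_wrt_append)
  moreover have "perm_of (Suc n) F \<in> permutations_of_set {1..Suc n}"
  proof -
    have "{1..Suc n} = insert (Suc n) {1..n}" by auto
    moreover have "Suc n \<notin> set xs \<union> set ys" using set(1) by simp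
    ultimately show ?thesis using set(2) set(1)[symmetric] unfolding p(2) permutations_of_set_def by simp
  qed
  ultimately show ?case by blast
qed (simp add: permutations_of_set_def)

section \<open>The position of the largest value along a rail\<close>

locale peo_extension = simplicial_extension +
  assumes peo: "digraph_on n (induced n A)" "peo_consistent n (induced n A)"
begin

text \<open>Counted from 0, whereas \<open>insert_at\<close> counts from 1; hence the
  \<open>Suc\<close> in \<open>perm_of_insert_at\<close>.\<close>

definition index :: "arcs \<Rightarrow> nat" where
  "index F = length (takeWhile (\<lambda>x. x \<noteq> Suc n) (perm_of (Suc n) F))"

lemma perm_of_M:
  assumes "E \<in> carrier M"
  shows "perm_of n E \<in> permutations_of_set {1..n}" "length (perm_of n E) = n" "Suc n \<notin> set (perm_of n E)"
    "distinct (perm_of n E)"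
proof -
  show p: "perm_of n E \<in> permutations_of_set {1..n}"
    using perm_of_linear_extension[OF peo assms] by blast
  then show "length (perm_of n E) = n" "Suc n \<notin> set (perm_of n E)" "distinct (perm_of n E)"
    using length_finite_permutations_of_set[of "perm_of n E" "{1..n}"]
    by (auto simp: permutations_of_set_def)
qed

lemma perm_of_split:
  assumes F: "F \<in> carrier L"
  obtains xs ys where "perm_of n (induced n F) = xs @ ys" "perm_of (Suc n) F = xs @ Suc n # ys"
    "index F = length xs"
    "\<And>x. (x, Suc n) \<in> F \<Longrightarrow> x \<in> set xs" "\<And>x. (Suc n, x) \<in> F \<Longrightarrow> x \<in> set ys"
    "is_sink F (Suc n) \<Longrightarrow> ys = []" "is_source F (Suc n) \<Longrightarrow> \<not> is_sink F (Suc n) \<Longrightarrow> xs = []"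
proof -
  note M = induced_closed[OF F]
  obtain xs ys where p: "perm_of n (induced n F) = xs @ ys" "perm_of (Suc n) F = xs @ Suc n # ys"
    and rest: "\<And>x. (x, Suc n) \<in> F \<Longrightarrow> x \<in> set xs" "\<And>x. (Suc n, x) \<in> F \<Longrightarrow> x \<in> set ys"
    "is_sink F (Suc n) \<Longrightarrow> ys = []" "is_source F (Suc n) \<Longrightarrow> \<not> is_sink F (Suc n) \<Longrightarrow> xs = []"
    using perm_of_extension[OF F] perm_of_linear_extension[OF peo M] by blast
  have "Suc n \<notin> set xs" using perm_of_M(3)[OF M] p(1) by simp
  then have "takeWhile (\<lambda>x. x \<noteq> Suc n) (xs @ Suc n # ys) = xs"
    by (subst takeWhile_append2) auto
  then have "index F = length xs" by (simp add: index_def p(2))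
  then show thesis using that p rest by blast
qed

lemma index_le:
  assumes F: "F \<in> carrier L"
  shows "index F \<le> n"
  by (rule perm_of_split[OF F]) (use perm_of_M(2)[OF induced_closed[OF F]] in simp)

lemma perm_of_insert_at:
  "F \<in> carrier L \<Longrightarrow> perm_of (Suc n) F = insert_at (Suc (index F)) (Suc n) (perm_of n (induced n F))"
  by (erule perm_of_split) (simp add: insert_at_Suc)

lemma index_sink:
  assumes F: "F \<in> carrier L" and "is_sink F (Suc n)"
  shows "index F = n" "perm_of (Suc n) F = perm_of n (induced n F) @ [Suc n]"
proof -
  obtain xs ys where p: "perm_of n (induced n F) = xs @ ys" "perm_of (Suc n) F = xs @ Suc n # ys"
    "index F = length xs" "ys = []"
    by (rule perm_of_split[OF F]) (use assms in blast)
  then show "index F = n" "perm_of (Suc n) F = perm_of n (induced n F) @ [Suc n]"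
    using perm_of_M(2)[OF induced_closed[OF F]] by auto
qed

lemma index_source:
  assumes F: "F \<in> carrier L" and "is_source F (Suc n)" "\<not> is_sink F (Suc n)"
  shows "index F = 0"
  by (rule perm_of_split[OF F]) (use assms in simp)

text \<open>Both words insert the new value into the same shorter word, once before and once behind
  \<open>x\<close>.\<close>

lemma index_less:
  assumes F: "F \<in> carrier L" and G: "G \<in> carrier L" and eq: "induced n F = induced n G"
    and x: "(Suc n, x) \<in> F" "(x, Suc n) \<in> G"
  shows "index F < index G"
proof (rule ccontr)
  assume "\<not> index F < index G"
  obtain xs ys where F': "perm_of n (induced n F) = xs @ ys" "index F = length xs" "x \<in> set ys"
    by (rule perm_of_split[OF F]) (use x(1) in blast)
  obtain us vs where G': "perm_of n (induced n F) = us @ vs" "index G = length us" "x \<in> set us"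
    by (rule perm_of_split[OF G]) (use x(2) eq in auto)
  have "us = take (length us) (us @ vs)" by simp
  also have "\<dots> = take (length us) (xs @ ys)" using F'(1) G'(1) by simp
  also have "\<dots> = take (length us) xs" using F'(2) G'(2) \<open>\<not> index F < index G\<close> by simp
  finally have "x \<in> set xs" using G'(3) in_set_takeD by metis
  then show False using F'(1,3) perm_of_M(4)[OF induced_closed[OF F]] by auto
qed

text \<open>If the index does not decrease, \<open>index_less\<close> forbids a vertex to change
  from in-neighbor in \<open>F\<close> to out-neighbor in \<open>G\<close>. For a source the kept
  arcs are those to out-neighbors, for a sink those from in-neighbors, whence the opposite
  directions.\<close>

lemma le_iff_index:
  assumes F: "F \<in> carrier L" and G: "G \<in> carrier L" and eq: "induced n F = induced n G"
    and le: "index F \<le> index G"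
  shows "is_source A (Suc n) \<Longrightarrow> F \<sqsubseteq>\<^bsub>L\<^esub> G" "is_sink A (Suc n) \<Longrightarrow> G \<sqsubseteq>\<^bsub>L\<^esub> F"
proof -
  have no: "\<not> ((Suc n, x) \<in> G \<and> (x, Suc n) \<in> F)" for x
    using index_less[OF G F eq[symmetric]] le by fastforce
  have refl: "induced n F \<sqsubseteq>\<^bsub>M\<^esub> induced n G" "induced n G \<sqsubseteq>\<^bsub>M\<^esub> induced n F"
    by (simp_all add: le_AR eq)
  { assume src: "is_source A (Suc n)"
    have "(u, v) \<in> F" if uv: "(u, v) \<in> A" "u = Suc n \<or> v = Suc n" "(u, v) \<in> G" for u v
    proof -
      have "u = Suc n" using src uv by (auto simp: is_source_def)
      then show ?thesis using no[of v] uv AR_orient[OF asym_A F, of u v] by auto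
    qed
    then show "F \<sqsubseteq>\<^bsub>L\<^esub> G" unfolding le_L_iff[OF F G] using refl by auto }
  { assume snk: "is_sink A (Suc n)"
    have "(u, v) \<in> G" if uv: "(u, v) \<in> A" "u = Suc n \<or> v = Suc n" "(u, v) \<in> F" for u v
    proof -
      have "v = Suc n" using snk uv by (auto simp: is_sink_def)
      then show ?thesis using no[of u] uv AR_orient[OF asym_A G, of u v] by auto
    qed
    then show "G \<sqsubseteq>\<^bsub>L\<^esub> F" unfolding le_L_iff[OF G F] using refl by auto }
qed

lemma index_inj:
  assumes F: "F \<in> carrier L" and G: "G \<in> carrier L" and eq: "induced n F = induced n G"
    and "index F = index G"
  shows "F = G"
proof -
  interpret partial_order L using asym_A by (rule partial_order_AR)
  show ?thesis
    using source_or_sink le_iff_index[OF F G eq] le_iff_index[OF G F eq[symmetric]] assms(4)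
      le_antisym[OF _ _ F G] by (metis order_refl)
qed

lemma perm_of_inj:
  assumes "F \<in> carrier L" "G \<in> carrier L" "perm_of (Suc n) F = perm_of (Suc n) G"
    "induced n F = induced n G"
  shows "F = G"
  by (rule index_inj[OF assms(1,2,4)]) (simp add: index_def assms(3))

lemma remove1_perm_of:
  assumes "F \<in> carrier L"
  shows "remove1 (Suc n) (perm_of (Suc n) F) = perm_of n (induced n F)"
  using perm_of_M(3)[OF induced_closed[OF assms]] by (simp add: perm_of_insert_at[OF assms])

end

lemma peo_extensionI:
  "digraph_on (Suc n) A \<Longrightarrow> peo_consistent (Suc n) A \<Longrightarrow> peo_extension n A"
  using peo_consistent_SucD by (simp add: peo_extension_def peo_extension_axioms_def)

text \<open>Deleting the largest value recovers the word of the restriction, and the index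
  identifies the element of the rail.\<close>

lemma inj_on_perm_of:
  "digraph_on n A \<Longrightarrow> peo_consistent n A \<Longrightarrow> inj_on (perm_of n) (carrier (AR A))"
proof (induction n arbitrary: A)
  case 0
  then have "A = {}" by (auto simp: digraph_on_def)
  then show ?case by (auto simp: carrier_AR inj_on_def)
next
  case (Suc n)
  interpret peo_extension n A using Suc.prems by (rule peo_extensionI)
  show ?case
  proof (rule inj_onI)
    fix F G assume FG: "F \<in> carrier L" "G \<in> carrier L" "perm_of (Suc n) F = perm_of (Suc n) G"
    then have "perm_of n (induced n F) = perm_of n (induced n G)"
      using remove1_perm_of[of F] remove1_perm_of[of G] by simp
    then have "induced n F = induced n G"
      using Suc.IH[OF peo] induced_closed[OF FG(1)] induced_closed[OF FG(2)] by (meson inj_onD)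
    with FG show "F = G" by (rule perm_of_inj)
  qed
qed


section \<open>Hamilton paths in lattice quotients\<close>

lemma successivelyI:
  "(\<And>ys x y zs. xs = ys @ x # y # zs \<Longrightarrow> P x y) \<Longrightarrow> successively P xs"
proof (induction xs rule: induct_list012)
  case (3 x y zs)
  have "successively P (y # zs)"
  proof (rule 3(2))
    fix us u v vs assume "y # zs = us @ u # v # vs"
    then show "P u v" using 3(3)[of "x # us" u v vs] by simp
  qed
  then show ?case using 3(3)[of "[]"] by simp
qed auto

definition transversal :: "'a set \<Rightarrow> 'a rel \<Rightarrow> 'a set \<Rightarrow> bool" where
  "transversal V r R \<longleftrightarrow> R \<subseteq> V \<and> (\<forall>x \<in> V. \<exists>!F. F \<in> R \<and> (x, F) \<in> r)"

definition quotient_adjacent :: "arcs \<Rightarrow> arcs rel \<Rightarrow> arcs \<Rightarrow> arcs \<Rightarrow> bool" where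
  "quotient_adjacent A r E F \<longleftrightarrow> cover_adjacent (lattice_quotient (AR A) r) (r `` {E}) (r `` {F})"

lemma quotient_adjacent_sym: "quotient_adjacent A r E F \<Longrightarrow> quotient_adjacent A r F E"
  by (auto simp: quotient_adjacent_def cover_adjacent_def)

text \<open>What the induction carries about the enumeration. Starting at the identity is part of it
  because the next start is obtained by appending the new value.\<close>

definition J_path :: "nat \<Rightarrow> arcs \<Rightarrow> arcs rel \<Rightarrow> arcs set \<Rightarrow> arcs list \<Rightarrow> bool" where
  "J_path n A r R Es \<longleftrightarrow> Es \<noteq> [] \<and> set Es = R \<and> distinct Es \<and> perm_of n (hd Es) = [1..<Suc n] \<and>
    J_run (perm_of n ` R) [perm_of n (hd Es)] (map (perm_of n) (tl Es)) \<and>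
    successively (quotient_adjacent A r) Es"

section \<open>One step of the construction: collapsed rails\<close>

locale rail_step = peo_extension n A + congruent_lattice "AR A" r
  for n :: nat and A :: arcs and r :: "arcs rel" +
  assumes lattice_M: "lattice (AR (induced n A))"
begin

sublocale rail_extension "AR A" r "AR (induced n A)" "induced n" "add_kept n A" "add_reversed n A"
proof -
  interpret M: lattice M by (rule lattice_M)
  show "rail_extension (AR A) r (AR (induced n A)) (induced n) (add_kept n A) (add_reversed n A)"
    by unfold_locales
      (rule induced_closed add_kept_closed add_reversed_closed add_kept_le_iff le_add_reversed_iff
        add_kept_down add_reversed_up; assumption)+
qed

lemma restrict_congruence_eq: "restrict_congruence n A r = restricted"
  by (auto simp: restrict_congruence_def restricted_def)

lemma rail_iff: "F \<in> rail n A E \<longleftrightarrow> F \<in> carrier (AR A) \<and> induced n F = E"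
  by (simp add: rail_def)

text \<open>Each rail lies in one class, so \<open>g\<close> matches the classes of
  \<open>restricted\<close> with those of \<open>r\<close>. Its values have the new vertex as a
  sink, so their words just append \<open>Suc n\<close> and the run is copied; the adjacencies are
  lifted by \<open>cover_adjacent_c\<close>.\<close>

lemma collapsed_step:
  assumes g: "g = add_kept n A \<or> g = add_reversed n A"
    and sink: "\<And>E. E \<in> carrier M \<Longrightarrow> is_sink (g E) (Suc n)"
    and coll: "\<And>E F G. \<lbrakk>E \<in> carrier M; F \<in> rail n A E; G \<in> rail n A E\<rbrakk> \<Longrightarrow> (F, G) \<in> r"
    and trans: "transversal (carrier M) restricted R"
    and path: "J_path n (induced n A) restricted R Es"
  shows "transversal (carrier (AR A)) r (g ` R) \<and> J_path (Suc n) A r (g ` R) (map g Es)"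
proof
  have R: "R \<subseteq> carrier M" using trans by (simp add: transversal_def)
  have g_closed: "g E \<in> carrier (AR A)" "induced n (g E) = E" if "E \<in> carrier M" for E
    using g add_kept_closed add_reversed_closed that by auto
  have g_cong: "(g E, g F) \<in> r \<longleftrightarrow> (E, F) \<in> restricted" if "E \<in> carrier M" "F \<in> carrier M" for E F
    using g restricted_iff_cbar[OF that] that by (auto simp: restricted_def)
  show "transversal (carrier (AR A)) r (g ` R)"
    unfolding transversal_def
  proof (intro conjI ballI)
    show "g ` R \<subseteq> carrier (AR A)" using R g_closed by blast
    fix x assume x: "x \<in> carrier (AR A)"
    then have Mx: "induced n x \<in> carrier M" by (rule induced_closed)
    have xg: "(x, g (induced n x)) \<in> r"
      using coll[OF Mx] g_closed[OF Mx] x by (simp add: rail_iff)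
    have iff: "(x, g E) \<in> r \<longleftrightarrow> (induced n x, E) \<in> restricted" if "E \<in> R" for E
      using g_cong[OF Mx, of E] that R xg r_sym r_trans by blast
    obtain E where E: "E \<in> R" "(induced n x, E) \<in> restricted"
      and uniq: "\<And>F. F \<in> R \<Longrightarrow> (induced n x, F) \<in> restricted \<Longrightarrow> F = E"
      using trans Mx unfolding transversal_def by metis
    show "\<exists>!F. F \<in> g ` R \<and> (x, F) \<in> r"
    proof (rule ex1I[of _ "g E"])
      show "g E \<in> g ` R \<and> (x, g E) \<in> r" using E iff by blast
      show "F = g E" if "F \<in> g ` R \<and> (x, F) \<in> r" for F using that iff uniq by blast
    qed
  qed
  have p: "Es \<noteq> []" "set Es = R" "distinct Es" "perm_of n (hd Es) = [1..<Suc n]"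
    "J_run (perm_of n ` R) [perm_of n (hd Es)] (map (perm_of n) (tl Es))"
    "successively (quotient_adjacent (induced n A) restricted) Es"
    using path unfolding J_path_def by blast+
  have g_perm: "perm_of (Suc n) (g E) = perm_of n E @ [Suc n]" if "E \<in> R" for E
    using index_sink(2)[of "g E"] g_closed[of E] sink[of E] that R by auto
  have hd_R: "hd Es \<in> R" and tl_R: "set (tl Es) \<subseteq> R"
    using p(1,2) list.set_sel(1)[of Es] list.set_sel(2)[of Es] by auto
  show "J_path (Suc n) A r (g ` R) (map g Es)"
    unfolding J_path_def
  proof (intro conjI)
    show "map g Es \<noteq> []" "set (map g Es) = g ` R" using p by simp_all
    have "inj_on g R" using g_closed(2) R by (metis inj_onI subsetD)
    then show "distinct (map g Es)" using p by (simp add: distinct_map)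
    show "perm_of (Suc n) (hd (map g Es)) = [1..<Suc (Suc n)]"
      using p(1,4) g_perm[OF hd_R] by (simp add: hd_map)
    have L: "perm_of n ` R \<subseteq> permutations_of_set {1..n}" using R perm_of_M(1) by blast
    have img: "perm_of (Suc n) ` g ` R = (\<lambda>p. p @ [Suc n]) ` perm_of n ` R"
      using g_perm by (force simp: image_iff)
    have "J_run (perm_of (Suc n) ` g ` R) (map (\<lambda>p. p @ [Suc n]) [perm_of n (hd Es)])
        (map (\<lambda>p. p @ [Suc n]) (map (perm_of n) (tl Es)))"
      unfolding img by (rule J_run_append_new[OF L p(5)]) (use hd_R tl_R in auto)
    moreover have "map (\<lambda>p. p @ [Suc n]) (map (perm_of n) (tl Es)) = map (perm_of (Suc n)) (tl (map g Es))"
      using tl_R g_perm by (auto simp: map_tl[symmetric])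
    ultimately show "J_run (perm_of (Suc n) ` g ` R) [perm_of (Suc n) (hd (map g Es))]
        (map (perm_of (Suc n)) (tl (map g Es)))"
      using g_perm[OF hd_R] p(1) by (simp add: hd_map)
    have "quotient_adjacent A r (g E) (g F)"
      if "quotient_adjacent (induced n A) restricted E F" "E \<in> R" "F \<in> R" for E F
      using g cover_adjacent_c[of E F] that R unfolding quotient_adjacent_def by blast
    then show "successively (quotient_adjacent A r) (map g Es)"
      unfolding successively_map using p(2,6) by (auto elim: successively_mono)
  qed
qed

end

section \<open>One step of the construction: separated rails\<close>

locale separated_step = rail_step +
  fixes R :: "arcs set" and S :: "arcs \<Rightarrow> arcs set"
  assumes separated: "\<And>E. E \<in> carrier M \<Longrightarrow> (add_kept n A E, add_reversed n A E) \<notin> r"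
    and S_rail: "\<And>E. E \<in> R \<Longrightarrow> S E \<subseteq> rail n A E"
    and S_unique: "\<And>E X. \<lbrakk>E \<in> R; X \<in> carrier (AR A) // r; X \<inter> rail n A E \<noteq> {}\<rbrakk> \<Longrightarrow>
             \<exists>!F. F \<in> X \<inter> rail n A E \<and> F \<in> S E"
    and S_ends: "\<And>E. E \<in> R \<Longrightarrow> add_kept n A E \<in> S E \<and> add_reversed n A E \<in> S E"
    and trans: "transversal (carrier M) restricted R"
begin

lemma R_closed: "E \<in> R \<Longrightarrow> E \<in> carrier M"
  using trans by (auto simp: transversal_def)

lemma S_mem: "E \<in> R \<Longrightarrow> F \<in> S E \<Longrightarrow> F \<in> carrier (AR A) \<and> induced n F = E"
  using S_rail rail_iff by blast

lemma S_obtain: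
  assumes E: "E \<in> R" and z: "z \<in> carrier (AR A)" "induced n z = E"
  obtains F where "F \<in> S E" "(z, F) \<in> r"
proof -
  have "z \<in> r `` {z} \<inter> rail n A E" using z r_refl by (simp add: rail_iff)
  then show thesis using S_unique[OF E, of "r `` {z}"] that quotientI[OF z(1), of r] by blast
qed

lemma S_inj:
  assumes E: "E \<in> R" and F: "F \<in> S E" and G: "G \<in> S E" and FG: "(F, G) \<in> r"
  shows "F = G"
proof -
  have FG': "F \<in> r `` {F} \<inter> rail n A E" "G \<in> r `` {F} \<inter> rail n A E"
    using S_mem[OF E] F G FG r_refl by (simp_all add: rail_iff)
  moreover have "r `` {F} \<in> carrier (AR A) // r" using S_mem[OF E F] by (blast intro: quotientI)
  ultimately show ?thesis using S_unique[OF E, of "r `` {F}"] F G by blast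
qed

text \<open>An element \<open>z\<close> between \<open>X\<close> and \<open>Y\<close> restricts to
  \<open>E\<close> by monotonicity, so it is congruent to some chosen \<open>W\<close>. As
  \<open>W\<close> lies outside the open interval, convexity of classes makes \<open>z\<close>
  congruent to \<open>X\<close> or to \<open>Y\<close>.\<close>

lemma separates_neighbors:
  assumes E: "E \<in> R" and X: "X \<in> S E" and Y: "Y \<in> S E" and ne: "X \<noteq> Y" and le: "X \<sqsubseteq>\<^bsub>AR A\<^esub> Y"
    and neighbors: "\<And>W. W \<in> S E \<Longrightarrow> W \<sqsubseteq>\<^bsub>AR A\<^esub> X \<or> Y \<sqsubseteq>\<^bsub>AR A\<^esub> W"
  shows "separates X Y"
proof -
  have cl: "X \<in> carrier (AR A)" "Y \<in> carrier (AR A)" "induced n X = E" "induced n Y = E"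
    using S_mem[OF E] X Y by auto
  have "(X, z) \<in> r \<or> (z, Y) \<in> r"
    if z: "z \<in> carrier (AR A)" "X \<sqsubseteq>\<^bsub>AR A\<^esub> z" "z \<sqsubseteq>\<^bsub>AR A\<^esub> Y" for z
  proof -
    have "induced n z = E"
      using M.le_antisym[OF res_mono[OF z(1) cl(2) z(3)] res_mono[OF cl(1) z(1,2), unfolded cl(3)[folded cl(4)]]]
        induced_closed z(1) cl R_closed[OF E] by simp
    then obtain W where W: "W \<in> S E" "(z, W) \<in> r" using S_obtain[OF E z(1)] by blast
    have cW: "W \<in> carrier (AR A)" using S_mem[OF E W(1)] by simp
    from neighbors[OF W(1)] show ?thesis
    proof
      assume WX: "W \<sqsubseteq>\<^bsub>AR A\<^esub> X"
      have "(W, X) \<in> r" by (rule r_convex[OF cW cl(1) z(1) WX z(2) r_sym[OF W(2)]])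
      then show ?thesis using W(2) r_sym r_trans by blast
    next
      assume YW: "Y \<sqsubseteq>\<^bsub>AR A\<^esub> W"
      have "(z, Y) \<in> r" by (rule r_convex[OF z(1) cl(2) cW z(3) YW W(2)])
      then show ?thesis ..
    qed
  qed
  moreover have "(X, Y) \<notin> r" using S_inj[OF E X Y] ne by blast
  ultimately show ?thesis using cl le by (simp add: separates_def)
qed

lemma adjacent_neighbors:
  assumes E: "E \<in> R" and F: "F \<in> S E" and G: "G \<in> S E" and less: "index F < index G"
    and neighbors: "\<And>W. W \<in> S E \<Longrightarrow> index W \<le> index F \<or> index G \<le> index W"
  shows "quotient_adjacent A r F G"
proof -
  note le = le_iff_index
  have mem: "W \<in> carrier (AR A)" "induced n W = E" if "W \<in> S E" for W
    using S_mem[OF E that] by auto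
  have ne: "F \<noteq> G" using less by auto
  from source_or_sink have "separates F G \<or> separates G F"
  proof
    assume src: "is_source A (Suc n)"
    have "F \<sqsubseteq>\<^bsub>AR A\<^esub> G" using le(1)[OF _ _ _ _ src] mem F G less by simp
    moreover have "W \<sqsubseteq>\<^bsub>AR A\<^esub> F \<or> G \<sqsubseteq>\<^bsub>AR A\<^esub> W" if "W \<in> S E" for W
      using le(1)[OF _ _ _ _ src] mem F G neighbors[OF that] that by metis
    ultimately show ?thesis using separates_neighbors[OF E F G ne] by blast
  next
    assume snk: "is_sink A (Suc n)"
    have "G \<sqsubseteq>\<^bsub>AR A\<^esub> F" using le(2)[OF _ _ _ _ snk] mem F G less by simp
    moreover have "W \<sqsubseteq>\<^bsub>AR A\<^esub> G \<or> F \<sqsubseteq>\<^bsub>AR A\<^esub> W" if "W \<in> S E" for W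
      using le(2)[OF _ _ _ _ snk] mem F G neighbors[OF that] that by metis
    ultimately show ?thesis using separates_neighbors[OF E G F ne[symmetric]] by blast
  qed
  then show ?thesis
    using separates_imp_covers unfolding quotient_adjacent_def cover_adjacent_def by blast
qed

text \<open>\<open>first\<close> and \<open>final\<close> are the ends of the rail in the order of
  word positions, not of the lattice: from left to right the rail ascends for a source and descends
  for a sink.\<close>

definition first :: "arcs \<Rightarrow> arcs" where
  "first = (if is_source A (Suc n) then add_kept n A else add_reversed n A)"

definition final :: "arcs \<Rightarrow> arcs" where
  "final = (if is_source A (Suc n) then add_reversed n A else add_kept n A)"

lemma index_ends:
  assumes E: "E \<in> R"
  shows "first E \<in> S E" "final E \<in> S E" "index (first E) = 0" "index (final E) = n"
    "is_sink (final E) (Suc n)"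
proof -
  note M = R_closed[OF E]
  show "first E \<in> S E" "final E \<in> S E" using S_ends[OF E] by (auto simp: first_def final_def)
  note cl = S_mem[OF E \<open>first E \<in> S E\<close>] S_mem[OF E \<open>final E \<in> S E\<close>]
  show snk: "is_sink (final E) (Suc n)"
    using source_or_sink mem_add_kept[OF M] mem_add_reversed[OF M]
    by (auto simp: final_def is_sink_def is_source_def)
  then show "index (final E) = n" using index_sink cl by blast
  have src: "is_source (first E) (Suc n)"
    using source_or_sink mem_add_kept[OF M] mem_add_reversed[OF M]
    by (auto simp: first_def is_sink_def is_source_def)
  \<comment> \<open>In the separated case the new vertex has a neighbor. This matters because
    \<open>perm_of\<close> tests for a sink first, and an isolated vertex would be put at the right
    end.\<close>
  have "add_kept n A E \<noteq> add_reversed n A E"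
    using separated[OF M] r_refl add_kept_closed(1)[OF M] by metis
  then obtain x where "(x, Suc n) \<in> A \<or> (Suc n, x) \<in> A"
    by (auto simp: add_kept_def add_reversed_def)
  then have "\<not> is_sink (first E) (Suc n)"
    using source_or_sink mem_add_kept[OF M] mem_add_reversed[OF M]
    by (auto simp: first_def is_sink_def is_source_def)
  then show "index (first E) = 0" using index_source src cl by blast
qed

text \<open>The indices are sorted instead of the reorientations, which are recovered by injectivity
  of \<open>index\<close> on a rail.\<close>

definition sorted_rail :: "arcs \<Rightarrow> arcs list" where
  "sorted_rail E = map (the_inv_into (S E) index) (sorted_list_of_set (index ` S E))"

lemma inj_on_index: "E \<in> R \<Longrightarrow> inj_on index (S E)"
  using S_mem index_inj by (metis inj_onI)

lemma index_image:
  assumes E: "E \<in> R"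
  shows "0 \<in> index ` S E" "n \<in> index ` S E" "index ` S E \<subseteq> {..n}" "finite (index ` S E)"
proof -
  show "0 \<in> index ` S E" "n \<in> index ` S E" using index_ends[OF E] by (metis imageI)+
  show "index ` S E \<subseteq> {..n}" using S_mem[OF E] index_le by auto
  then show "finite (index ` S E)" by (rule finite_subset) simp
qed

lemma inv_index:
  assumes "E \<in> R" "F \<in> S E"
  shows "the_inv_into (S E) index (index F) = F"
  using the_inv_into_f_f[OF inj_on_index[OF assms(1)] assms(2)] .

lemma sorted_rail:
  assumes E: "E \<in> R"
  shows "set (sorted_rail E) = S E" "distinct (sorted_rail E)" "sorted_rail E \<noteq> []"
    "hd (sorted_rail E) = first E" "last (sorted_rail E) = final E"
    "map index (sorted_rail E) = sorted_list_of_set (index ` S E)"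
    "successively (quotient_adjacent A r) (sorted_rail E)"
proof -
  let ?T = "index ` S E" and ?g = "the_inv_into (S E) index"
  note T = index_image[OF E]
  note ends = ends_sorted_list_of_set[OF T(1-3)]
  show "set (sorted_rail E) = S E"
    using T(4) inv_index[OF E] by (simp add: sorted_rail_def image_image)
  show mi: "map index (sorted_rail E) = sorted_list_of_set ?T"
    using T(4) inv_index[OF E] by (auto simp: sorted_rail_def intro!: map_idI)
  then show "distinct (sorted_rail E)"
    using distinct_map distinct_sorted_list_of_set by metis
  show "sorted_rail E \<noteq> []" using ends(1) by (simp add: sorted_rail_def)
  show "hd (sorted_rail E) = first E" "last (sorted_rail E) = final E"
    using ends inv_index[OF E] index_ends[OF E] by (metis hd_map last_map sorted_rail_def)+
  show "successively (quotient_adjacent A r) (sorted_rail E)"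
    unfolding sorted_rail_def successively_map
  proof (rule successivelyI)
    fix hs i j ks assume split: "sorted_list_of_set ?T = hs @ i # j # ks"
    have set: "set (hs @ i # j # ks) = ?T" using T(4) split by (metis set_sorted_list_of_set)
    have sorted: "sorted_wrt (<) (hs @ i # j # ks)"
      using strict_sorted_list_of_set[of ?T] split by simp
    have "i \<in> ?T" "j \<in> ?T" using set by auto
    then obtain F G where F: "F \<in> S E" "index F = i" and G: "G \<in> S E" "index G = j" by blast
    have "index W \<le> index F \<or> index G \<le> index W" if "W \<in> S E" for W
    proof -
      have "index W \<in> set (hs @ i # j # ks)" using set that by blast
      then show ?thesis using sorted F(2) G(2) by (auto simp: sorted_wrt_append)
    qed
    moreover have "index F < index G" using sorted F(2) G(2) by (auto simp: sorted_wrt_append)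
    ultimately have "quotient_adjacent A r F G" by (intro adjacent_neighbors[OF E F(1) G(1)])
    then show "quotient_adjacent A r (?g i) (?g j)"
      using inv_index[OF E F(1)] inv_index[OF E G(1)] F(2) G(2) by simp
  qed
qed

text \<open>Existence: by \<open>restricted_rail\<close>, every element is congruent to one on a
  rail over \<open>R\<close>, where its class has a chosen element. Uniqueness: by
  \<open>restricted_res\<close>, congruent elements have congruent restrictions, which singles out
  the rail, and \<open>S_inj\<close> the element on it.\<close>

lemma transversal_S: "transversal (carrier (AR A)) r (\<Union>E \<in> R. S E)"
  unfolding transversal_def
proof (intro conjI ballI)
  show "(\<Union>E \<in> R. S E) \<subseteq> carrier (AR A)" using S_mem by blast
  fix x assume x: "x \<in> carrier (AR A)"
  obtain E where E: "E \<in> R" "(induced n x, E) \<in> restricted"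
    and uniq: "\<And>F. F \<in> R \<Longrightarrow> (induced n x, F) \<in> restricted \<Longrightarrow> F = E"
    using trans induced_closed[OF x] unfolding transversal_def by metis
  obtain y where y: "y \<in> carrier (AR A)" "induced n y = E" "(x, y) \<in> r"
    using restricted_rail[OF x E(2)] by blast
  obtain F where F: "F \<in> S E" "(y, F) \<in> r" using S_obtain[OF E(1) y(1,2)] by blast
  show "\<exists>!F. F \<in> (\<Union>E \<in> R. S E) \<and> (x, F) \<in> r"
  proof (rule ex1I[of _ F])
    show "F \<in> (\<Union>E \<in> R. S E) \<and> (x, F) \<in> r" using E(1) F y(3) r_trans by blast
    fix G assume "G \<in> (\<Union>E \<in> R. S E) \<and> (x, G) \<in> r"
    then obtain E' where E': "E' \<in> R" "G \<in> S E'" and xG: "(x, G) \<in> r" by blast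
    then have "E' = E" using uniq restricted_res[OF xG] S_mem by simp
    moreover have "(F, G) \<in> r" using F(2) y(3) xG r_sym r_trans by blast
    ultimately show "G = F" using S_inj[OF E(1) F(1)] E'(2) by blast
  qed
qed

lemma positions_perm_of:
  assumes E: "E \<in> R"
  shows "positions n (perm_of (Suc n) ` (\<Union>E \<in> R. S E)) (perm_of n E) = sorted_list_of_set (index ` S E)"
proof -
  have "i \<le> n \<and> insert_at (Suc i) (Suc n) (perm_of n E) \<in> perm_of (Suc n) ` (\<Union>E \<in> R. S E) \<longleftrightarrow>
    i \<in> index ` S E" for i
  proof
    assume i: "i \<le> n \<and> insert_at (Suc i) (Suc n) (perm_of n E) \<in> perm_of (Suc n) ` (\<Union>E \<in> R. S E)"
    then obtain E' F where F: "E' \<in> R" "F \<in> S E'"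
      "insert_at (Suc i) (Suc n) (perm_of n E) = perm_of (Suc n) F" by blast
    note F' = S_mem[OF F(1,2)]
    note new = perm_of_M(3)[OF R_closed[OF E]]
    have "perm_of n E = perm_of n E'"
      using remove1_perm_of[of F] F' F(3) remove1_insert_at[OF new, of i] by simp
    then have EE: "E' = E"
      using inj_on_perm_of[OF peo] R_closed E F(1) by (metis inj_onD)
    then have "insert_at (Suc i) (Suc n) (perm_of n E) = insert_at (Suc (index F)) (Suc n) (perm_of n E)"
      using F(3) F' perm_of_insert_at[of F] by simp
    then have "i = index F"
      using insert_at_inj[OF new] i index_le F' perm_of_M(2)[OF R_closed[OF E]] by simp
    then show "i \<in> index ` S E" using F(2) EE by blast
  next
    assume "i \<in> index ` S E"
    then obtain F where F: "F \<in> S E" "i = index F" by blast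
    then show "i \<le> n \<and> insert_at (Suc i) (Suc n) (perm_of n E) \<in> perm_of (Suc n) ` (\<Union>E \<in> R. S E)"
      using S_mem[OF E F(1)] index_le perm_of_insert_at[of F] E by force
  qed
  then show ?thesis by (simp add: positions_def)
qed

text \<open>Identifies the sweeps of Algorithm J with the rails, so that the zigzag of permutations
  is the image of the zigzag of reorientations.\<close>

lemma block_perm_of:
  assumes E: "E \<in> R"
  shows "block n (perm_of (Suc n) ` (\<Union>E \<in> R. S E)) (perm_of n E) = map (perm_of (Suc n)) (sorted_rail E)"
proof -
  have "map (perm_of (Suc n)) (sorted_rail E) =
    map (\<lambda>i. insert_at (Suc i) (Suc n) (perm_of n E)) (map index (sorted_rail E))"
    using S_mem[OF E] sorted_rail(1)[OF E] perm_of_insert_at by simp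
  then show ?thesis using sorted_rail(6)[OF E] by (simp add: block_def positions_perm_of[OF E])
qed

lemma zigzag_extension:
  "zigzag_extension n (perm_of n ` R) (perm_of (Suc n) ` (\<Union>E \<in> R. S E))"
proof
  show "perm_of n ` R \<subseteq> permutations_of_set {1..n}" using R_closed perm_of_M(1) by blast
next
  fix q assume "q \<in> perm_of (Suc n) ` (\<Union>E \<in> R. S E)"
  then obtain E F where "E \<in> R" "F \<in> S E" "q = perm_of (Suc n) F" by blast
  then show "\<exists>p \<in> perm_of n ` R. \<exists>i \<le> n. q = insert_at (Suc i) (Suc n) p"
    using S_mem[of E F] perm_of_insert_at[of F] index_le[of F] by blast
next
  fix p b assume "p \<in> perm_of n ` R"
  then obtain E where E: "E \<in> R" "p = perm_of n E" by blast
  note ends = index_ends[OF E(1)]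
  have "extend b (Suc n) p = perm_of (Suc n) (if b then final E else first E)"
    using S_mem[OF E(1) ends(1)] S_mem[OF E(1) ends(2)] ends(3,4) perm_of_M(2)[OF R_closed[OF E(1)]]
      perm_of_insert_at E(2) by (simp add: extend_insert_at)
  then show "extend b (Suc n) p \<in> perm_of (Suc n) ` (\<Union>E \<in> R. S E)"
    using ends(1,2) E(1) by auto
qed

lemma J_path_zigzag:
  assumes path: "J_path n (induced n A) restricted R Es"
  shows "J_path (Suc n) A r (\<Union>E \<in> R. S E) (zigzag sorted_rail True Es)"
proof -
  let ?L' = "perm_of (Suc n) ` (\<Union>E \<in> R. S E)"
  have p: "Es \<noteq> []" "set Es = R" "distinct Es" "perm_of n (hd Es) = [1..<Suc n]"
    "J_run (perm_of n ` R) [perm_of n (hd Es)] (map (perm_of n) (tl Es))"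
    "successively (quotient_adjacent (induced n A) restricted) Es"
    using path unfolding J_path_def by blast+
  obtain E Es' where Es: "Es = E # Es'" using p(1) by (cases Es) auto
  have E: "E \<in> R" using p(2) Es by auto
  interpret zigzag_extension n "perm_of n ` R" ?L' by (rule zigzag_extension)
  have map_eq: "map (perm_of (Suc n)) (zigzag sorted_rail True Es) =
    zigzag (block n ?L') True (map (perm_of n) Es)"
    using p(2) block_perm_of by (intro map_zigzag) simp
  obtain qs where qs: "zigzag (block n ?L') True (map (perm_of n) Es) = ext True (perm_of n E) # qs"
    "J_run ?L' [ext True (perm_of n E)] qs"
    using J_run_zigzag_init[of "perm_of n E" "map (perm_of n) Es'"] p(2,5) Es by auto
  obtain F Fs where Fs: "zigzag sorted_rail True Es = F # Fs"
    using map_eq qs(1) by (cases "zigzag sorted_rail True Es") auto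
  have F: "perm_of (Suc n) F = ext True (perm_of n E)" "map (perm_of (Suc n)) Fs = qs"
    using map_eq qs(1) Fs by auto
  have "distinct (zigzag sorted_rail True Es)"
  proof (rule distinct_zigzag)
    show "distinct Es" by (rule p)
    show "distinct (sorted_rail G)" if "G \<in> set Es" for G using that p(2) sorted_rail(2) by simp
    show "set (sorted_rail G) \<inter> set (sorted_rail H) = {}"
      if "G \<in> set Es" "H \<in> set Es" "G \<noteq> H" for G H
      using that p(2) sorted_rail(1) S_mem by (metis disjoint_iff)
  qed
  moreover have "set (zigzag sorted_rail True Es) = (\<Union>E \<in> R. S E)"
    using p(2) sorted_rail(1) by (simp add: set_zigzag)
  moreover have "successively (quotient_adjacent A r) (zigzag sorted_rail True Es)"
  proof (rule successively_zigzag[where Q = "quotient_adjacent (induced n A) restricted"])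
    show "sorted_rail G \<noteq> [] \<and> successively (quotient_adjacent A r) (sorted_rail G)" if "G \<in> set Es" for G
      using that p(2) sorted_rail(3,7) by simp
    fix G H assume GH: "G \<in> set Es" "H \<in> set Es" "quotient_adjacent (induced n A) restricted G H"
    \<comment> \<open>\<open>first\<close> and \<open>final\<close> are each uniformly
      \<open>add_kept\<close> or \<open>add_reversed\<close>, so crossings at equal borders are
      crossings between equal ends of rails.\<close>
    then have "quotient_adjacent A r (first G) (first H)" "quotient_adjacent A r (final G) (final H)"
      using cover_adjacent_c[of G H] R_closed p(2)
      unfolding quotient_adjacent_def first_def final_def by auto
    then show "quotient_adjacent A r (hd (sorted_rail G)) (hd (sorted_rail H)) \<and>
      quotient_adjacent A r (last (sorted_rail G)) (last (sorted_rail H))"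
      using GH p(2) sorted_rail(4,5) by simp
  qed (use p(6) quotient_adjacent_sym in blast)+
  moreover have "perm_of (Suc n) F = [1..<Suc (Suc n)]"
    using F(1) p(4) Es by (simp add: extend_def)
  moreover have "J_run ?L' [perm_of (Suc n) F] (map (perm_of (Suc n)) Fs)"
    using F qs(2) by simp
  ultimately show ?thesis unfolding J_path_def Fs by simp
qed

end

section \<open>Induction along the construction and conclusion\<close>

lemma J_path_constructed:
  "constructed n A r R \<Longrightarrow> digraph_on n A \<Longrightarrow> peo_consistent n A \<Longrightarrow> lattice_congruence (AR A) r \<Longrightarrow>
    transversal (carrier (AR A)) r R \<and> (\<exists>Es. J_path n A r R Es)"
proof (induction rule: constructed.induct)
  case (empty r)
  have carrier: "carrier (AR {}) = {{}}" by (auto simp: carrier_AR acyclic_def)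
  then have "({}, {}) \<in> r"
    using empty.prems(3) by (auto simp: lattice_congruence_def equiv_def refl_on_def)
  then have "transversal (carrier (AR {})) r {{}}"
    unfolding carrier transversal_def by auto
  moreover have "J_path 0 {} r {{}} [{}]" by (simp add: J_path_def)
  ultimately show ?case by blast
next
  case (separated n A r R S)
  interpret peo_extension n A by (rule peo_extensionI[OF separated.prems(1,2)])
  interpret rail_step n A r
    using lattice_AR_peo_consistent[OF separated.prems(1,2)] lattice_AR_peo_consistent[OF peo] separated.prems(3)
    by (intro rail_step.intro rail_step_axioms.intro congruent_lattice.intro
        congruent_lattice_axioms.intro peo_extension_axioms)
  have IH: "transversal (carrier M) restricted R" "\<exists>Es. J_path n (induced n A) restricted R Es"
    using separated.IH[OF peo] restricted_congruence by (simp_all add: restrict_congruence_eq)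
  interpret separated_step n A r R S
    by unfold_locales (use separated.hyps IH(1) in blast)+
  show ?case using transversal_S J_path_zigzag IH(2) by blast
next
  case (collapsed_sink n A r R)
  interpret peo_extension n A by (rule peo_extensionI[OF collapsed_sink.prems(1,2)])
  interpret rail_step n A r
    using lattice_AR_peo_consistent[OF collapsed_sink.prems(1,2)] lattice_AR_peo_consistent[OF peo]
      collapsed_sink.prems(3)
    by (intro rail_step.intro rail_step_axioms.intro congruent_lattice.intro
        congruent_lattice_axioms.intro peo_extension_axioms)
  have IH: "transversal (carrier M) restricted R" "\<exists>Es. J_path n (induced n A) restricted R Es"
    using collapsed_sink.IH[OF peo] restricted_congruence by (simp_all add: restrict_congruence_eq)
  have "is_sink (add_kept n A E) (Suc n)" if "E \<in> carrier M" for E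
    using mem_add_kept[OF that] collapsed_sink.hyps(3) by (auto simp: is_sink_def)
  then show ?case
    using collapsed_step[of "add_kept n A" R] collapsed_sink.hyps(2) IH by blast
next
  case (collapsed_source n A r R)
  interpret peo_extension n A by (rule peo_extensionI[OF collapsed_source.prems(1,2)])
  interpret rail_step n A r
    using lattice_AR_peo_consistent[OF collapsed_source.prems(1,2)] lattice_AR_peo_consistent[OF peo]
      collapsed_source.prems(3)
    by (intro rail_step.intro rail_step_axioms.intro congruent_lattice.intro
        congruent_lattice_axioms.intro peo_extension_axioms)
  have IH: "transversal (carrier M) restricted R" "\<exists>Es. J_path n (induced n A) restricted R Es"
    using collapsed_source.IH[OF peo] restricted_congruence by (simp_all add: restrict_congruence_eq)
  have "is_sink (add_reversed n A E) (Suc n)" if "E \<in> carrier M" for E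
    using mem_add_reversed[OF that] collapsed_source.hyps(3) by (auto simp: is_sink_def is_source_def)
  then show ?case
    using collapsed_step[of "add_reversed n A" R] collapsed_source.hyps(2) IH by blast
qed

theorem theorem35:
  fixes n :: nat and A :: arcs and r :: "arcs rel" and R :: "arcs set"
  assumes "digraph_on n A"
    and "peo_consistent n A"
    and "lattice_congruence (AR A) r"
    and "constructed n A r R"
  shows "\<exists>Es :: arcs list.
    set Es \<subseteq> carrier (AR A) \<and>
    set (map (perm_of n) Es) \<subseteq> perm_of n ` R \<and>
    algorithm_J_generates n (perm_of n ` R) [1..<n + 1] (map (perm_of n) Es) \<and>
    hamilton_path (carrier (lattice_quotient (AR A) r))
      (cover_adjacent (lattice_quotient (AR A) r)) (map (\<lambda>E. r `` {E}) Es)"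
proof -
  obtain Es where trans: "transversal (carrier (AR A)) r R" and path: "J_path n A r R Es"
    using J_path_constructed assms by blast
  have R: "R \<subseteq> carrier (AR A)" and rep: "\<And>x. x \<in> carrier (AR A) \<Longrightarrow> \<exists>!F. F \<in> R \<and> (x, F) \<in> r"
    using trans by (auto simp: transversal_def)
  have p: "Es \<noteq> []" "set Es = R" "distinct Es" "perm_of n (hd Es) = [1..<Suc n]"
    "J_run (perm_of n ` R) [perm_of n (hd Es)] (map (perm_of n) (tl Es))"
    "successively (quotient_adjacent A r) Es"
    using path unfolding J_path_def by blast+
  interpret congruent_lattice "AR A" r
    using lattice_AR_peo_consistent[OF assms(1,2)] assms(3)
    by (intro congruent_lattice.intro congruent_lattice_axioms.intro)
  have perms: "perm_of n ` R \<subseteq> permutations_of_set {1..n}"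
    using R perm_of_linear_extension[OF assms(1,2)] by blast
  have Es: "map (perm_of n) Es = perm_of n (hd Es) # map (perm_of n) (tl Es)"
    using p(1) by (cases Es) auto
  have "algorithm_J_generates n (perm_of n ` R) (perm_of n (hd Es)) (perm_of n (hd Es) # map (perm_of n) (tl Es))"
  proof (rule J_run_generates[OF perms _ p(5)])
    show "perm_of n (hd Es) \<in> perm_of n ` R" using p(1,2) by auto
    show "set (perm_of n (hd Es) # map (perm_of n) (tl Es)) = perm_of n ` R"
      unfolding Es[symmetric] using p(2) by simp
  qed
  then have J: "algorithm_J_generates n (perm_of n ` R) [1..<n + 1] (map (perm_of n) Es)"
    unfolding Es[symmetric] using p(4) by simp
  have "inj_on (\<lambda>E. r `` {E}) R"
  proof (rule inj_onI)
    fix E F assume EF: "E \<in> R" "F \<in> R" "r `` {E} = r `` {F}"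
    then have "E \<in> carrier (AR A)" "(E, F) \<in> r" using R class_eq_iff[of E F] by auto
    then show "E = F" using rep[of E] EF(1,2) r_refl by blast
  qed
  moreover have "(\<lambda>E. r `` {E}) ` R = carrier (AR A) // r"
  proof (intro equalityI subsetI)
    show "X \<in> carrier (AR A) // r" if "X \<in> (\<lambda>E. r `` {E}) ` R" for X
      using that R by (auto intro: quotientI)
    fix X assume "X \<in> carrier (AR A) // r"
    then obtain x where x: "x \<in> carrier (AR A)" "X = r `` {x}" by (rule quotientE)
    obtain F where F: "F \<in> R" "(x, F) \<in> r" using rep[OF x(1)] by blast
    then have "X = r `` {F}" using x class_eq_iff R by blast
    then show "X \<in> (\<lambda>E. r `` {E}) ` R" using F by blast
  qed
  ultimately have "hamilton_path (carrier (lattice_quotient (AR A) r))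
      (cover_adjacent (lattice_quotient (AR A) r)) (map (\<lambda>E. r `` {E}) Es)"
    using p(2,3,6)
    by (simp add: hamilton_path_def carrier_quotient distinct_map successively_map
        quotient_adjacent_def[abs_def])
  then show ?thesis using J R p(2) by (intro exI[of _ Es]) auto
qed

end
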